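(* Let $R$ be a commutative $\mathbf{Q}$-algebra. Let $\mathfrak{g}$ be a Lie algebra over $R$ graded in a torsion-free abelian group $A$, i.e. $\mathfrak{g}=\bigoplus_{\alpha\in A}\mathfrak{g}_\alpha$ with $[\mathfrak{g}_\alpha,\mathfrak{g}_\beta]\subset\mathfrak{g}_{\alpha+\beta}$. Then the reduced Koszul map $\bar\eta:H_3(\mathfrak{g})\to\mathrm{Kill}(\mathfrak{g})$ is zero in every nonzero degree, i.e. $\bar\eta(H_3(\mathfrak{g})_\alpha)=0$ for every $\alpha\in A\smallsetminus\{0\}$.
   Context: The ground ring $R$ is commutative, associative, with unit; tensor, exterior and symmetric powers are over $R$. A Lie algebra over $R$ is an $R$-module with an $R$-bilinear bracket satisfying $[x,x]=0$ and the Jacobi identity. $H_*(\mathfrak{g})$ is the homology of the Chevalley–Eilenberg complex $\Lambda^*\mathfrak{g}$ with $\partial_n(x_1\wedge\dots\wedge x_n)=\sum_{i<j}(-1)^{i+j}[x_i,x_j]\wedge x_1\wedge\dots\wedge\hat{x_i}\wedge\dots\wedge\hat{x_j}\wedge\dots\wedge x_n$, and $Z_3(\mathfrak{g})=\ker\partial_3$, $B_3(\mathfrak{g})=\mathrm{im}\,\partial_4$. Writing $x\odot y$ for the product in the symmetric square $S^2\mathfrak{g}$, the Killing module $\mathrm{Kill}(\mathfrak{g})$ is the cokernel of the map $\mathfrak{g}^{\otimes 3}\to S^2\mathfrak{g}$, $x\otimes y\otimes z\mapsto [x,y]\odot z-x\odot[y,z]$. The Koszul map $\eta:\Lambda^3\mathfrak{g}\to\mathrm{Kill}(\mathfrak{g})$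 is the (well-defined) homomorphism sending $x\wedge y\wedge z$ to the class of $x\odot[y,z]$. It vanishes on $B_3(\mathfrak{g})$, and the reduced Koszul map $\bar\eta:H_3(\mathfrak{g})\to\mathrm{Kill}(\mathfrak{g})$ is induced by restricting $\eta$ to $Z_3(\mathfrak{g})$. A grading of $\mathfrak{g}$ in an abelian group $A$ induces $A$-gradings on tensor, exterior and symmetric powers (degrees add), hence on $H_3(\mathfrak{g})$ and $\mathrm{Kill}(\mathfrak{g})$, and $\eta,\bar\eta$ are graded maps. *)

theory Defs
  imports "HOL-Algebra.Algebra" "HOL-Algebra.Algebraic_Closure_Type"
begin

section \<open>Modules over a commutative ring\<close>

text \<open>The multiplicative fields of a module record play no role and are left undefined.\<close>

definition lin_maps ::
  "('r, 'k) ring_scheme \<Rightarrow> ('r, 'm, 'u) module_scheme \<Rightarrow> ('r, 'n, 'v) module_scheme \<Rightarrow> ('m \<Rightarrow> 'n) set"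
  where "lin_maps R M N =
    {f \<in> carrier M \<rightarrow>\<^sub>E carrier N.
       (\<forall>x\<in>carrier M. \<forall>y\<in>carrier M. f (x \<oplus>\<^bsub>M\<^esub> y) = f x \<oplus>\<^bsub>N\<^esub> f y) \<and>
       (\<forall>a\<in>carrier R. \<forall>x\<in>carrier M. f (a \<odot>\<^bsub>M\<^esub> x) = a \<odot>\<^bsub>N\<^esub> f x)}"

text \<open>The \<open>R\<close>-linear map \<open>M \<rightarrow> N\<close> that sends the generator \<open>e i\<close> of \<open>M\<close> to \<open>v i\<close>, for all \<open>i \<in> I\<close>.
  It is only used where such a map exists; it is then unique, because the \<open>e i\<close> generate \<open>M\<close> and
  linear maps are taken extensional.\<close>

definition the_lin ::
  "('r, 'k) ring_scheme \<Rightarrow> ('r, 'm, 'u) module_scheme \<Rightarrow> ('r, 'n, 'v) module_scheme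
    \<Rightarrow> 'i set \<Rightarrow> ('i \<Rightarrow> 'm) \<Rightarrow> ('i \<Rightarrow> 'n) \<Rightarrow> 'm \<Rightarrow> 'n"
  where "the_lin R M N I e v = (THE f. f \<in> lin_maps R M N \<and> (\<forall>i\<in>I. f (e i) = v i))"

definition submod_span ::
  "('r, 'k) ring_scheme \<Rightarrow> ('r, 'm, 'u) module_scheme \<Rightarrow> 'm set \<Rightarrow> 'm set"
  where "submod_span R M S = \<Inter>{H. submodule H R M \<and> S \<subseteq> H}"

definition quot_mod ::
  "('r, 'm, 'u) module_scheme \<Rightarrow> 'm set \<Rightarrow> ('r, 'm set) module"
  where "quot_mod M H =
    \<lparr> carrier = a_rcosets\<^bsub>M\<^esub> H, monoid.mult = undefined, one = undefined,
      ring.zero = H, add = (<+>\<^bsub>M\<^esub>),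
      module.smult = (\<lambda>a C. \<Union>x\<in>C. H +>\<^bsub>M\<^esub> (a \<odot>\<^bsub>M\<^esub> x)) \<rparr>"

definition free_mod :: "('r, 'k) ring_scheme \<Rightarrow> 'x set \<Rightarrow> ('r, 'x \<Rightarrow> 'r) module"
  where "free_mod R S =
    \<lparr> carrier = {f \<in> UNIV \<rightarrow> carrier R. finite {x. f x \<noteq> \<zero>\<^bsub>R\<^esub>} \<and> {x. f x \<noteq> \<zero>\<^bsub>R\<^esub>} \<subseteq> S},
      monoid.mult = undefined, one = undefined,
      ring.zero = (\<lambda>x. \<zero>\<^bsub>R\<^esub>), add = (\<lambda>f g x. f x \<oplus>\<^bsub>R\<^esub> g x),
      module.smult = (\<lambda>a f x. a \<otimes>\<^bsub>R\<^esub> f x) \<rparr>"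

definition free_gen :: "('r, 'k) ring_scheme \<Rightarrow> 'x \<Rightarrow> 'x \<Rightarrow> 'r"
  where "free_gen R x = (\<lambda>y. if y = x then \<one>\<^bsub>R\<^esub> else \<zero>\<^bsub>R\<^esub>)"


section \<open>Tensor powers, exterior powers and the symmetric square\<close>

definition tuples :: "('r, 'm, 'u) module_scheme \<Rightarrow> nat \<Rightarrow> 'm list set"
  where "tuples M n = {xs. length xs = n \<and> set xs \<subseteq> carrier M}"

definition tensor_rels ::
  "('r, 'k) ring_scheme \<Rightarrow> ('r, 'm, 'u) module_scheme \<Rightarrow> nat \<Rightarrow> ('m list \<Rightarrow> 'r) set"
  where "tensor_rels R M n =
    (let F = free_mod R (tuples M n); d = free_gen R in
      {d (xs[i := x \<oplus>\<^bsub>M\<^esub> y]) \<ominus>\<^bsub>F\<^esub> (d (xs[i := x]) \<oplus>\<^bsub>F\<^esub> d (xs[i := y])) | xs i x y.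
         xs \<in> tuples M n \<and> i < n \<and> x \<in> carrier M \<and> y \<in> carrier M} \<union>
      {d (xs[i := a \<odot>\<^bsub>M\<^esub> x]) \<ominus>\<^bsub>F\<^esub> a \<odot>\<^bsub>F\<^esub> d (xs[i := x]) | xs i a x.
         xs \<in> tuples M n \<and> i < n \<and> a \<in> carrier R \<and> x \<in> carrier M})"

definition tensor_power ::
  "('r, 'k) ring_scheme \<Rightarrow> ('r, 'm, 'u) module_scheme \<Rightarrow> nat \<Rightarrow> ('r, ('m list \<Rightarrow> 'r) set) module"
  where "tensor_power R M n =
    quot_mod (free_mod R (tuples M n))
      (submod_span R (free_mod R (tuples M n)) (tensor_rels R M n))"

definition tensor ::
  "('r, 'k) ring_scheme \<Rightarrow> ('r, 'm, 'u) module_scheme \<Rightarrow> 'm list \<Rightarrow> ('m list \<Rightarrow> 'r) set"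
  where "tensor R M xs =
    submod_span R (free_mod R (tuples M (length xs))) (tensor_rels R M (length xs))
      +>\<^bsub>free_mod R (tuples M (length xs))\<^esub> free_gen R xs"

text \<open>The exterior and symmetric powers are quotients of the tensor power, so their elements are cosets of
  cosets.\<close>

definition ext_kernel ::
  "('r, 'k) ring_scheme \<Rightarrow> ('r, 'm, 'u) module_scheme \<Rightarrow> nat \<Rightarrow> ('m list \<Rightarrow> 'r) set set"
  where "ext_kernel R M n =
    submod_span R (tensor_power R M n) {tensor R M xs | xs. xs \<in> tuples M n \<and> \<not> distinct xs}"

definition ext_power ::
  "('r, 'k) ring_scheme \<Rightarrow> ('r, 'm, 'u) module_scheme \<Rightarrow> nat \<Rightarrow> ('r, ('m list \<Rightarrow> 'r) set set) module"
  where "ext_power R M n = quot_mod (tensor_power R M n) (ext_kernel R M n)"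

definition wedge ::
  "('r, 'k) ring_scheme \<Rightarrow> ('r, 'm, 'u) module_scheme \<Rightarrow> 'm list \<Rightarrow> ('m list \<Rightarrow> 'r) set set"
  where "wedge R M xs =
    ext_kernel R M (length xs) +>\<^bsub>tensor_power R M (length xs)\<^esub> tensor R M xs"

definition sym_kernel ::
  "('r, 'k) ring_scheme \<Rightarrow> ('r, 'm, 'u) module_scheme \<Rightarrow> ('m list \<Rightarrow> 'r) set set"
  where "sym_kernel R M =
    submod_span R (tensor_power R M 2)
      {tensor R M [x, y] \<ominus>\<^bsub>tensor_power R M 2\<^esub> tensor R M [y, x] | x y.
         x \<in> carrier M \<and> y \<in> carrier M}"

definition sym_square ::
  "('r, 'k) ring_scheme \<Rightarrow> ('r, 'm, 'u) module_scheme \<Rightarrow> ('r, ('m list \<Rightarrow> 'r) set set) module"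
  where "sym_square R M = quot_mod (tensor_power R M 2) (sym_kernel R M)"

definition sym_prod ::
  "('r, 'k) ring_scheme \<Rightarrow> ('r, 'm, 'u) module_scheme \<Rightarrow> 'm \<Rightarrow> 'm \<Rightarrow> ('m list \<Rightarrow> 'r) set set"
  where "sym_prod R M x y = sym_kernel R M +>\<^bsub>tensor_power R M 2\<^esub> tensor R M [x, y]"


section \<open>Lie algebras and gradings\<close>

locale lie_algebra = module R L
  for R :: "('r, 'k) ring_scheme" (structure) and L :: "('r, 'g, 'u) module_scheme" (structure) +
  fixes br :: "'g \<Rightarrow> 'g \<Rightarrow> 'g"
  assumes br_closed: "x \<in> carrier L \<Longrightarrow> y \<in> carrier L \<Longrightarrow> br x y \<in> carrier L"
    and br_add_left:
      "x \<in> carrier L \<Longrightarrow> y \<in> carrier L \<Longrightarrow> z \<in> carrier L \<Longrightarrow>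
        br (x \<oplus>\<^bsub>L\<^esub> y) z = br x z \<oplus>\<^bsub>L\<^esub> br y z"
    and br_add_right:
      "x \<in> carrier L \<Longrightarrow> y \<in> carrier L \<Longrightarrow> z \<in> carrier L \<Longrightarrow>
        br x (y \<oplus>\<^bsub>L\<^esub> z) = br x y \<oplus>\<^bsub>L\<^esub> br x z"
    and br_smult_left:
      "a \<in> carrier R \<Longrightarrow> x \<in> carrier L \<Longrightarrow> y \<in> carrier L \<Longrightarrow>
        br (a \<odot>\<^bsub>L\<^esub> x) y = a \<odot>\<^bsub>L\<^esub> br x y"
    and br_smult_right:
      "a \<in> carrier R \<Longrightarrow> x \<in> carrier L \<Longrightarrow> y \<in> carrier L \<Longrightarrow>
        br x (a \<odot>\<^bsub>L\<^esub> y) = a \<odot>\<^bsub>L\<^esub> br x y"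
    and br_self: "x \<in> carrier L \<Longrightarrow> br x x = \<zero>\<^bsub>L\<^esub>"
    and jacobi:
      "x \<in> carrier L \<Longrightarrow> y \<in> carrier L \<Longrightarrow> z \<in> carrier L \<Longrightarrow>
        br x (br y z) \<oplus>\<^bsub>L\<^esub> br y (br z x) \<oplus>\<^bsub>L\<^esub> br z (br x y) = \<zero>\<^bsub>L\<^esub>"

definition torsion_free_group :: "('a, 'k) ring_scheme \<Rightarrow> bool"
  where "torsion_free_group A \<longleftrightarrow>
    (\<forall>a\<in>carrier A. \<forall>n::nat. 0 < n \<longrightarrow> [n] \<cdot>\<^bsub>A\<^esub> a = \<zero>\<^bsub>A\<^esub> \<longrightarrow> a = \<zero>\<^bsub>A\<^esub>)"

definition internal_direct_sum ::
  "('r, 'k) ring_scheme \<Rightarrow> ('r, 'm, 'u) module_scheme \<Rightarrow> 'a set \<Rightarrow> ('a \<Rightarrow> 'm set) \<Rightarrow> bool"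
  where "internal_direct_sum R M I G \<longleftrightarrow>
    (\<forall>i\<in>I. submodule (G i) R M) \<and>
    (\<forall>x\<in>carrier M. \<exists>!f. f \<in> Pi\<^sub>E I G \<and> finite {i\<in>I. f i \<noteq> \<zero>\<^bsub>M\<^esub>} \<and>
       x = (\<Oplus>\<^bsub>M\<^esub>i\<in>{i\<in>I. f i \<noteq> \<zero>\<^bsub>M\<^esub>}. f i))"

definition lie_grading ::
  "('r, 'k) ring_scheme \<Rightarrow> ('r, 'g, 'u) module_scheme \<Rightarrow> ('g \<Rightarrow> 'g \<Rightarrow> 'g)
    \<Rightarrow> ('a, 'l) ring_scheme \<Rightarrow> ('a \<Rightarrow> 'g set) \<Rightarrow> bool"
  where "lie_grading R L br A G \<longleftrightarrow>
    internal_direct_sum R L (carrier A) G \<and>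
    (\<forall>\<alpha>\<in>carrier A. \<forall>\<beta>\<in>carrier A. \<forall>x\<in>G \<alpha>. \<forall>y\<in>G \<beta>. br x y \<in> G (\<alpha> \<oplus>\<^bsub>A\<^esub> \<beta>))"


section \<open>Chevalley--Eilenberg homology\<close>

text \<open>\<open>ce_boundary R L br n\<close> is \<open>\<partial>\<^sub>n\<close>; for \<open>n = 0\<close>, where \<open>n - 1 = 0\<close>, it is the zero map.
  Positions in a list are numbered from 0, which changes \<open>i + j\<close> by 2 and so does
  not affect the sign.\<close>

definition ce_boundary ::
  "('r, 'k) ring_scheme \<Rightarrow> ('r, 'g, 'u) module_scheme \<Rightarrow> ('g \<Rightarrow> 'g \<Rightarrow> 'g) \<Rightarrow> nat
    \<Rightarrow> ('g list \<Rightarrow> 'r) set set \<Rightarrow> ('g list \<Rightarrow> 'r) set set"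
  where "ce_boundary R L br n =
    the_lin R (ext_power R L n) (ext_power R L (n - 1)) (tuples L n) (wedge R L)
      (\<lambda>xs. \<Oplus>\<^bsub>ext_power R L (n - 1)\<^esub>j\<in>{..<n}. \<Oplus>\<^bsub>ext_power R L (n - 1)\<^esub>i\<in>{..<j}.
         ((\<ominus>\<^bsub>R\<^esub> \<one>\<^bsub>R\<^esub>) [^]\<^bsub>R\<^esub> (i + j)) \<odot>\<^bsub>ext_power R L (n - 1)\<^esub>
           wedge R L (br (xs ! i) (xs ! j) # nths xs (- {i, j})))"

definition ce_cycles ::
  "('r, 'k) ring_scheme \<Rightarrow> ('r, 'g, 'u) module_scheme \<Rightarrow> ('g \<Rightarrow> 'g \<Rightarrow> 'g) \<Rightarrow> nat
    \<Rightarrow> ('g list \<Rightarrow> 'r) set set set"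
  where "ce_cycles R L br n =
    {z \<in> carrier (ext_power R L n). ce_boundary R L br n z = \<zero>\<^bsub>ext_power R L (n - 1)\<^esub>}"

definition ce_boundaries ::
  "('r, 'k) ring_scheme \<Rightarrow> ('r, 'g, 'u) module_scheme \<Rightarrow> ('g \<Rightarrow> 'g \<Rightarrow> 'g) \<Rightarrow> nat
    \<Rightarrow> ('g list \<Rightarrow> 'r) set set set"
  where "ce_boundaries R L br n =
    ce_boundary R L br (n + 1) ` carrier (ext_power R L (n + 1))"

definition ce_homology ::
  "('r, 'k) ring_scheme \<Rightarrow> ('r, 'g, 'u) module_scheme \<Rightarrow> ('g \<Rightarrow> 'g \<Rightarrow> 'g) \<Rightarrow> nat
    \<Rightarrow> ('r, ('g list \<Rightarrow> 'r) set set set) module"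
  where "ce_homology R L br n =
    quot_mod (ext_power R L n\<lparr>carrier := ce_cycles R L br n\<rparr>) (ce_boundaries R L br n)"

definition homology_class ::
  "('r, 'k) ring_scheme \<Rightarrow> ('r, 'g, 'u) module_scheme \<Rightarrow> ('g \<Rightarrow> 'g \<Rightarrow> 'g) \<Rightarrow> nat
    \<Rightarrow> ('g list \<Rightarrow> 'r) set set \<Rightarrow> ('g list \<Rightarrow> 'r) set set set"
  where "homology_class R L br n z = ce_boundaries R L br n +>\<^bsub>ext_power R L n\<^esub> z"

definition ext_power_deg ::
  "('r, 'k) ring_scheme \<Rightarrow> ('r, 'g, 'u) module_scheme
    \<Rightarrow> ('a, 'l) ring_scheme \<Rightarrow> ('a \<Rightarrow> 'g set) \<Rightarrow> nat \<Rightarrow> 'a \<Rightarrow> ('g list \<Rightarrow> 'r) set set set"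
  where "ext_power_deg R L A G n \<alpha> =
    submod_span R (ext_power R L n)
      {wedge R L xs | xs d. length xs = n \<and> d \<in> {..<n} \<rightarrow> carrier A \<and>
         (\<forall>i<n. xs ! i \<in> G (d i)) \<and> (\<Oplus>\<^bsub>A\<^esub>i\<in>{..<n}. d i) = \<alpha>}"

text \<open>\<open>\<partial>\<close> is graded, so the part of \<open>H\<^sub>n\<close> in degree \<open>\<alpha>\<close> consists of the classes of the cycles that are
  homogeneous of degree \<open>\<alpha>\<close>.\<close>

definition ce_homology_deg ::
  "('r, 'k) ring_scheme \<Rightarrow> ('r, 'g, 'u) module_scheme \<Rightarrow> ('g \<Rightarrow> 'g \<Rightarrow> 'g)
    \<Rightarrow> ('a, 'l) ring_scheme \<Rightarrow> ('a \<Rightarrow> 'g set) \<Rightarrow> nat \<Rightarrow> 'a \<Rightarrow> ('g list \<Rightarrow> 'r) set set set set"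
  where "ce_homology_deg R L br A G n \<alpha> =
    homology_class R L br n ` (ce_cycles R L br n \<inter> ext_power_deg R L A G n \<alpha>)"


section \<open>The Killing module and the Koszul maps\<close>

definition kill_rel_map ::
  "('r, 'k) ring_scheme \<Rightarrow> ('r, 'g, 'u) module_scheme \<Rightarrow> ('g \<Rightarrow> 'g \<Rightarrow> 'g)
    \<Rightarrow> ('g list \<Rightarrow> 'r) set \<Rightarrow> ('g list \<Rightarrow> 'r) set set"
  where "kill_rel_map R L br =
    the_lin R (tensor_power R L 3) (sym_square R L)
      (carrier L \<times> carrier L \<times> carrier L) (\<lambda>(x, y, z). tensor R L [x, y, z])
      (\<lambda>(x, y, z). sym_prod R L (br x y) z \<ominus>\<^bsub>sym_square R L\<^esub> sym_prod R L x (br y z))"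

definition killing_module ::
  "('r, 'k) ring_scheme \<Rightarrow> ('r, 'g, 'u) module_scheme \<Rightarrow> ('g \<Rightarrow> 'g \<Rightarrow> 'g)
    \<Rightarrow> ('r, ('g list \<Rightarrow> 'r) set set set) module"
  where "killing_module R L br =
    quot_mod (sym_square R L) (kill_rel_map R L br ` carrier (tensor_power R L 3))"

definition kill_class ::
  "('r, 'k) ring_scheme \<Rightarrow> ('r, 'g, 'u) module_scheme \<Rightarrow> ('g \<Rightarrow> 'g \<Rightarrow> 'g)
    \<Rightarrow> ('g list \<Rightarrow> 'r) set set \<Rightarrow> ('g list \<Rightarrow> 'r) set set set"
  where "kill_class R L br s =
    kill_rel_map R L br ` carrier (tensor_power R L 3) +>\<^bsub>sym_square R L\<^esub> s"

definition koszul_map ::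
  "('r, 'k) ring_scheme \<Rightarrow> ('r, 'g, 'u) module_scheme \<Rightarrow> ('g \<Rightarrow> 'g \<Rightarrow> 'g)
    \<Rightarrow> ('g list \<Rightarrow> 'r) set set \<Rightarrow> ('g list \<Rightarrow> 'r) set set set"
  where "koszul_map R L br =
    the_lin R (ext_power R L 3) (killing_module R L br)
      (carrier L \<times> carrier L \<times> carrier L) (\<lambda>(x, y, z). wedge R L [x, y, z])
      (\<lambda>(x, y, z). kill_class R L br (sym_prod R L x (br y z)))"

definition reduced_koszul_map ::
  "('r, 'k) ring_scheme \<Rightarrow> ('r, 'g, 'u) module_scheme \<Rightarrow> ('g \<Rightarrow> 'g \<Rightarrow> 'g)
    \<Rightarrow> ('g list \<Rightarrow> 'r) set set set \<Rightarrow> ('g list \<Rightarrow> 'r) set set set"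
  where "reduced_koszul_map R L br =
    the_lin R (ce_homology R L br 3) (killing_module R L br)
      (ce_cycles R L br 3) (homology_class R L br 3) (koszul_map R L br)"

end

(* Since A is torsion-free, there is an additive f : A -> Q with f(alpha) = 1. Let D scale the
  component of degree a by f(a). On exterior squares, theta(u /\ v) = Du.v - u.Dv is well defined
  with values in Kill, and for homogeneous x, y, z of degrees a, b, c the invariance of the
  universal form gives theta(d(x /\ y /\ z)) = -(f(a) + f(b) + f(c)) eta(x /\ y /\ z).
  Hence eta = -theta d in degree alpha, which vanishes on cycles. *)
theory Submission
  imports Defs
begin

section \<open>Linear maps, submodules and quotients\<close>

text \<open>Why the coefficient in the overview is a sum: the bracket of x and y has degree a + b,
  so the wedge of [x,y] with z contributes f(a) + f(b) - f(c). Invariance turns the three pairings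
  into the same class up to sign, and in the sum of the three coefficients every value occurs twice
  with plus and once with minus. In degree \<alpha> the result is f(\<alpha>) = 1, so nothing has to
  be divided in R. Symmetry of the universal form makes Du.v - u.Dv vanish for u = v, which is what
  \<theta> needs. The existence of f rests on the divisibility of the rationals. The obstacle is the
  form of the definitions: every structural map is a definite description on cosets of cosets, and
  says nothing until a linear map with the prescribed values is exhibited. This calls for universal
  properties of all modules involved, for alternation of the boundary formula in degrees 3 and 4,
  and for the vanishing of \<eta> on boundaries.\<close>

definition is_linear ::
  "('r, 'k) ring_scheme \<Rightarrow> ('r, 'm, 'u) module_scheme \<Rightarrow> ('r, 'n, 'v) module_scheme \<Rightarrow> ('m \<Rightarrow> 'n) \<Rightarrow> bool"
  where "is_linear R M N f \<longleftrightarrow> f \<in> carrier M \<rightarrow> carrier N \<and>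
    (\<forall>x\<in>carrier M. \<forall>y\<in>carrier M. f (x \<oplus>\<^bsub>M\<^esub> y) = f x \<oplus>\<^bsub>N\<^esub> f y) \<and>
    (\<forall>a\<in>carrier R. \<forall>x\<in>carrier M. f (a \<odot>\<^bsub>M\<^esub> x) = a \<odot>\<^bsub>N\<^esub> f x)"

lemma is_linearI:
  assumes "\<And>x. x \<in> carrier M \<Longrightarrow> f x \<in> carrier N"
    and "\<And>x y. x \<in> carrier M \<Longrightarrow> y \<in> carrier M \<Longrightarrow> f (x \<oplus>\<^bsub>M\<^esub> y) = f x \<oplus>\<^bsub>N\<^esub> f y"
    and "\<And>a x. a \<in> carrier R \<Longrightarrow> x \<in> carrier M \<Longrightarrow> f (a \<odot>\<^bsub>M\<^esub> x) = a \<odot>\<^bsub>N\<^esub> f x"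
  shows "is_linear R M N f"
  using assms by (auto simp: is_linear_def)

lemma is_linearD:
  assumes "is_linear R M N f"
  shows "x \<in> carrier M \<Longrightarrow> f x \<in> carrier N"
    and "x \<in> carrier M \<Longrightarrow> y \<in> carrier M \<Longrightarrow> f (x \<oplus>\<^bsub>M\<^esub> y) = f x \<oplus>\<^bsub>N\<^esub> f y"
    and "a \<in> carrier R \<Longrightarrow> x \<in> carrier M \<Longrightarrow> f (a \<odot>\<^bsub>M\<^esub> x) = a \<odot>\<^bsub>N\<^esub> f x"
  using assms by (auto simp: is_linear_def)

text \<open>\<open>lin_maps\<close> also demands extensionality, which pointwise sums and
  compositions do not keep. \<open>is_linear\<close> isolates the rest; extensionality is restored
  by \<open>restrict\<close> where uniqueness is at stake.\<close>

lemma lin_maps_iff: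
  "f \<in> lin_maps R M N \<longleftrightarrow> is_linear R M N f \<and> f \<in> extensional (carrier M)"
  by (auto simp: lin_maps_def is_linear_def PiE_def)

lemma is_linear_compose:
  "is_linear R M N f \<Longrightarrow> is_linear R N P g \<Longrightarrow> is_linear R M P (\<lambda>x. g (f x))"
  by (auto simp: is_linear_def Pi_def)

lemma is_linear_restrict:
  assumes "module R M" and "is_linear R M N f"
  shows "restrict f (carrier M) \<in> lin_maps R M N"
proof -
  interpret M: module R M by fact
  show ?thesis using assms(2) by (auto simp: lin_maps_def is_linear_def)
qed

lemma is_linear_zero:
  assumes "module R M" "module R N" "is_linear R M N f"
  shows "f \<zero>\<^bsub>M\<^esub> = \<zero>\<^bsub>N\<^esub>"
proof -
  interpret M: module R M by fact
  interpret N: module R N by fact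
  have "f (\<zero>\<^bsub>R\<^esub> \<odot>\<^bsub>M\<^esub> \<zero>\<^bsub>M\<^esub>) = \<zero>\<^bsub>R\<^esub> \<odot>\<^bsub>N\<^esub> f \<zero>\<^bsub>M\<^esub>"
    using is_linearD(3)[OF assms(3)] by blast
  then show ?thesis using is_linearD(1)[OF assms(3), of "\<zero>\<^bsub>M\<^esub>"] by simp
qed

lemma module_neg:
  assumes "module R M" "x \<in> carrier M"
  shows "\<ominus>\<^bsub>M\<^esub> x = (\<ominus>\<^bsub>R\<^esub> \<one>\<^bsub>R\<^esub>) \<odot>\<^bsub>M\<^esub> x"
proof -
  interpret M: module R M by fact
  show ?thesis using assms(2) by (simp add: M.smult_l_minus)
qed

lemma is_linear_neg:
  assumes "module R M" "module R N" "is_linear R M N f" "x \<in> carrier M"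
  shows "f (\<ominus>\<^bsub>M\<^esub> x) = \<ominus>\<^bsub>N\<^esub> f x"
proof -
  interpret M: module R M by fact
  show ?thesis
    using assms(4) is_linearD(3)[OF assms(3)] is_linearD(1)[OF assms(3)]
    by (simp add: module_neg[OF assms(1)] module_neg[OF assms(2)])
qed

lemma is_linear_minus:
  assumes "module R M" "module R N" "is_linear R M N f" "x \<in> carrier M" "y \<in> carrier M"
  shows "f (x \<ominus>\<^bsub>M\<^esub> y) = f x \<ominus>\<^bsub>N\<^esub> f y"
proof -
  interpret M: module R M by fact
  show ?thesis
    using assms(4,5) is_linearD(2)[OF assms(3)] is_linear_neg[OF assms(1-3)]
    by (simp add: a_minus_def)
qed

lemma is_linear_add:
  assumes "module R N" "is_linear R M N f" "is_linear R M N g"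
  shows "is_linear R M N (\<lambda>x. f x \<oplus>\<^bsub>N\<^esub> g x)"
proof -
  interpret N: module R N by fact
  note f = is_linearD[OF assms(2)] and g = is_linearD[OF assms(3)]
  show ?thesis
    by (rule is_linearI) (simp_all add: f g N.smult_r_distr N.a_ac)
qed

lemma is_linear_smult:
  assumes "module R N" "is_linear R M N f" "c \<in> carrier R"
  shows "is_linear R M N (\<lambda>x. c \<odot>\<^bsub>N\<^esub> f x)"
proof -
  interpret N: module R N by fact
  note f = is_linearD[OF assms(2)]
  have "c \<odot>\<^bsub>N\<^esub> (a \<odot>\<^bsub>N\<^esub> y) = a \<odot>\<^bsub>N\<^esub> (c \<odot>\<^bsub>N\<^esub> y)" if "a \<in> carrier R" "y \<in> carrier N" for a y
    using that assms(3) by (simp flip: N.smult_assoc1 add: N.m_comm)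
  then show ?thesis
    by (intro is_linearI) (simp_all add: f N.smult_r_distr assms(3))
qed

lemma submodule_memD:
  assumes "module R M" "submodule H R M"
  shows "x \<in> H \<Longrightarrow> x \<in> carrier M" and "\<zero>\<^bsub>M\<^esub> \<in> H"
    and "x \<in> H \<Longrightarrow> y \<in> H \<Longrightarrow> x \<oplus>\<^bsub>M\<^esub> y \<in> H"
    and "x \<in> H \<Longrightarrow> y \<in> H \<Longrightarrow> x \<ominus>\<^bsub>M\<^esub> y \<in> H"
    and "a \<in> carrier R \<Longrightarrow> x \<in> H \<Longrightarrow> a \<odot>\<^bsub>M\<^esub> x \<in> H"
proof -
  interpret M: module R M by fact
  note E = M.submoduleE[OF assms(2)]
  show "x \<in> H \<Longrightarrow> x \<in> carrier M" "x \<in> H \<Longrightarrow> y \<in> H \<Longrightarrow> x \<oplus>\<^bsub>M\<^esub> y \<in> H"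
    "x \<in> H \<Longrightarrow> y \<in> H \<Longrightarrow> x \<ominus>\<^bsub>M\<^esub> y \<in> H" "a \<in> carrier R \<Longrightarrow> x \<in> H \<Longrightarrow> a \<odot>\<^bsub>M\<^esub> x \<in> H"
    using E by (auto simp: a_minus_def)
  show "\<zero>\<^bsub>M\<^esub> \<in> H"
    using subgroup.one_closed[OF submodule.axioms(1)[OF assms(2)]] by simp
qed

text \<open>Negatives come from scalars, since negation is multiplication by
  \<open>\<ominus> \<one>\<close>.\<close>

lemma submoduleI':
  assumes "module R M" "H \<subseteq> carrier M" "\<zero>\<^bsub>M\<^esub> \<in> H"
    and "\<And>x y. x \<in> H \<Longrightarrow> y \<in> H \<Longrightarrow> x \<oplus>\<^bsub>M\<^esub> y \<in> H"
    and "\<And>a x. a \<in> carrier R \<Longrightarrow> x \<in> H \<Longrightarrow> a \<odot>\<^bsub>M\<^esub> x \<in> H"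
  shows "submodule H R M"
proof -
  interpret M: module R M by fact
  show ?thesis
    by (rule M.submoduleI)
      (use assms module_neg[OF assms(1)] in \<open>auto simp: subset_iff intro: M.R.a_inv_closed\<close>)
qed

text \<open>The source of all arguments on generators: if two linear maps agree on a generating set,
  the submodule on which they agree is everything.\<close>

lemma submodule_equalizer:
  assumes "module R M" "module R N" "is_linear R M N f" "is_linear R M N g"
  shows "submodule {x \<in> carrier M. f x = g x} R M"
proof -
  interpret M: module R M by fact
  show ?thesis
    using is_linearD[OF assms(3)] is_linearD[OF assms(4)]
      is_linear_zero[OF assms(1,2,3)] is_linear_zero[OF assms(1,2,4)]
    by (intro submoduleI' assms(1)) auto
qed

lemma is_linear_const_zero:
  assumes "module R N"
  shows "is_linear R M N (\<lambda>x. \<zero>\<^bsub>N\<^esub>)"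
proof -
  interpret N: module R N by fact
  show ?thesis by (rule is_linearI) auto
qed

lemma submodule_kernel:
  assumes "module R M" "module R N" "is_linear R M N f"
  shows "submodule {x \<in> carrier M. f x = \<zero>\<^bsub>N\<^esub>} R M"
  using submodule_equalizer[OF assms is_linear_const_zero[OF assms(2)]] .

lemma submodule_vimage:
  assumes "module R M" "module R N" "is_linear R M N f" "submodule H R N"
  shows "submodule {x \<in> carrier M. f x \<in> H} R M"
proof -
  interpret M: module R M by fact
  show ?thesis
    using is_linearD[OF assms(3)] submodule_memD[OF assms(2,4)] is_linear_zero[OF assms(1-3)]
    by (intro submoduleI' assms(1)) auto
qed

lemma submodule_image:
  assumes "module R M" "module R N" "is_linear R M N f"
  shows "submodule (f ` carrier M) R N"
proof -
  interpret M: module R M by fact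
  note f = is_linearD[OF assms(3)]
  show ?thesis
  proof (rule submoduleI'[OF assms(2)])
    show "\<zero>\<^bsub>N\<^esub> \<in> f ` carrier M"
      using is_linear_zero[OF assms] M.M.zero_closed by (metis imageI)
  qed (use f in \<open>auto simp flip: f(2,3)\<close>)
qed

text \<open>The inclusion of \<open>S\<close> in the carrier makes the intersection run over a
  nonempty family, since \<open>carrier M\<close> itself takes part; an empty intersection would be
  \<open>UNIV\<close>.\<close>

lemma submodule_submod_span:
  assumes "module R M" "S \<subseteq> carrier M"
  shows "submodule (submod_span R M S) R M"
proof -
  interpret M: module R M by fact
  have c: "submodule (carrier M) R M" by (rule M.carrier_is_submodule)
  show ?thesis
  proof (rule submoduleI'[OF assms(1)])
    show "submod_span R M S \<subseteq> carrier M"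
      using c assms(2) by (auto simp: submod_span_def)
  qed (auto simp: submod_span_def intro: submodule_memD[OF assms(1)])
qed

lemma submod_span_incl: "S \<subseteq> submod_span R M S"
  by (auto simp: submod_span_def)

lemma submod_span_least: "submodule H R M \<Longrightarrow> S \<subseteq> H \<Longrightarrow> submod_span R M S \<subseteq> H"
  by (auto simp: submod_span_def)

text \<open>Generation is expressed by minimality instead of finite linear combinations. In this
  form it passes to quotients by taking preimages of submodules, and combines directly with
  \<open>submodule_equalizer\<close>.\<close>

definition generates ::
  "('r, 'k) ring_scheme \<Rightarrow> ('r, 'm, 'u) module_scheme \<Rightarrow> 'm set \<Rightarrow> bool"
  where "generates R M S \<longleftrightarrow> S \<subseteq> carrier M \<and> (\<forall>H. submodule H R M \<longrightarrow> S \<subseteq> H \<longrightarrow> carrier M \<subseteq> H)"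

lemma generates_eqI:
  assumes "module R M" "module R N" "is_linear R M N f" "is_linear R M N g" "generates R M S"
    and "\<And>x. x \<in> S \<Longrightarrow> f x = g x" "x \<in> carrier M"
  shows "f x = g x"
  using submodule_equalizer[OF assms(1-4)] assms(5-7) unfolding generates_def by blast

text \<open>Existence comes from any linear \<open>g\<close> with the prescribed values, cut down to
  the carrier; uniqueness comes from generation on the carrier and from extensionality off
  it.\<close>

lemma the_lin_props:
  assumes M: "module R M" and N: "module R N" and gen: "generates R M (e ` I)"
    and g: "is_linear R M N g" "\<And>i. i \<in> I \<Longrightarrow> g (e i) = v i"
  shows "is_linear R M N (the_lin R M N I e v)"
    and "\<And>i. i \<in> I \<Longrightarrow> the_lin R M N I e v (e i) = v i"
proof -
  have e: "e i \<in> carrier M" if "i \<in> I" for i using gen that by (auto simp: generates_def)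
  have "\<exists>!f. f \<in> lin_maps R M N \<and> (\<forall>i\<in>I. f (e i) = v i)"
  proof (rule ex1I[of _ "restrict g (carrier M)"])
    show "restrict g (carrier M) \<in> lin_maps R M N \<and> (\<forall>i\<in>I. restrict g (carrier M) (e i) = v i)"
      using is_linear_restrict[OF M g(1)] g(2) e by auto
  next
    fix f assume f: "f \<in> lin_maps R M N \<and> (\<forall>i\<in>I. f (e i) = v i)"
    show "f = restrict g (carrier M)"
    proof (rule extensionalityI[of _ "carrier M"])
      show "f \<in> extensional (carrier M)" using f by (simp add: lin_maps_iff)
      show "f x = restrict g (carrier M) x" if "x \<in> carrier M" for x
      proof -
        have "is_linear R M N f" "\<And>y. y \<in> e ` I \<Longrightarrow> f y = g y"
          using f g(2) by (auto simp: lin_maps_iff)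
        from generates_eqI[OF M N this(1) g(1) gen this(2) that] show ?thesis using that by simp
      qed
    qed simp
  qed
  from theI'[OF this] show "is_linear R M N (the_lin R M N I e v)"
    "\<And>i. i \<in> I \<Longrightarrow> the_lin R M N I e v (e i) = v i"
    by (auto simp: the_lin_def lin_maps_iff)
qed

section \<open>Quotient modules and their universal property\<close>

lemma abelian_subgroup_submodule:
  assumes "module R M" "submodule H R M"
  shows "abelian_subgroup H M"
proof -
  interpret M: module R M by fact
  show ?thesis
    using assms(2) M.M.abelian_group_axioms
    by (intro abelian_subgroupI3 additive_subgroupI submodule.axioms(1))
qed

lemma quot_mod_carrierE:
  assumes "C \<in> carrier (quot_mod M H)"
  obtains x where "x \<in> carrier M" "C = H +>\<^bsub>M\<^esub> x"
  using assms by (auto simp: quot_mod_def A_RCOSETS_def')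

lemma quot_mod_zero: "\<zero>\<^bsub>quot_mod M H\<^esub> = H"
  by (simp add: quot_mod_def)

context
  fixes R :: "('r, 'k) ring_scheme" and M :: "('r, 'm, 'u) module_scheme" and H :: "'m set"
  assumes M: "module R M" and H: "submodule H R M"
begin

interpretation M: module R M by (fact M)
interpretation H: abelian_subgroup H M by (rule abelian_subgroup_submodule[OF M H])

lemma coset_eq_iff:
  "x \<in> carrier M \<Longrightarrow> y \<in> carrier M \<Longrightarrow> H +>\<^bsub>M\<^esub> x = H +>\<^bsub>M\<^esub> y \<longleftrightarrow> x \<ominus>\<^bsub>M\<^esub> y \<in> H"
  by (metis H.a_rcos_self H.a_repr_independence' H.a_rcos_module_imp H.a_rcos_module_rev a_minus_def)

lemma coset_zero_iff: "x \<in> carrier M \<Longrightarrow> H +>\<^bsub>M\<^esub> x = H \<longleftrightarrow> x \<in> H"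
  by (metis H.a_rcos_const H.a_rcos_self)

lemma quot_mod_memI: "x \<in> carrier M \<Longrightarrow> H +>\<^bsub>M\<^esub> x \<in> carrier (quot_mod M H)"
  by (auto simp: quot_mod_def A_RCOSETS_def')

lemma quot_mod_add:
  "x \<in> carrier M \<Longrightarrow> y \<in> carrier M \<Longrightarrow>
    (H +>\<^bsub>M\<^esub> x) \<oplus>\<^bsub>quot_mod M H\<^esub> (H +>\<^bsub>M\<^esub> y) = H +>\<^bsub>M\<^esub> (x \<oplus>\<^bsub>M\<^esub> y)"
  by (simp add: quot_mod_def H.a_rcos_sum)

text \<open>Scalar multiplication on the quotient is a union over all representatives. Each
  contributes the same coset, because two representatives differ by an element of \<open>H\<close>;
  the union is over a nonempty set and so equals that coset.\<close>

lemma quot_mod_smult: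
  assumes "a \<in> carrier R" "x \<in> carrier M"
  shows "a \<odot>\<^bsub>quot_mod M H\<^esub> (H +>\<^bsub>M\<^esub> x) = H +>\<^bsub>M\<^esub> (a \<odot>\<^bsub>M\<^esub> x)"
proof -
  have "H +>\<^bsub>M\<^esub> (a \<odot>\<^bsub>M\<^esub> y) = H +>\<^bsub>M\<^esub> (a \<odot>\<^bsub>M\<^esub> x)" if "y \<in> H +>\<^bsub>M\<^esub> x" for y
  proof -
    have y: "y \<in> carrier M" using that assms by (metis H.a_elemrcos_carrier)
    then have "y \<ominus>\<^bsub>M\<^esub> x \<in> H" using that assms
      by (metis H.a_rcos_module_imp a_minus_def)
    then have "a \<odot>\<^bsub>M\<^esub> (y \<ominus>\<^bsub>M\<^esub> x) \<in> H" using submodule_memD(5)[OF M H] assms by blast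
    then show ?thesis using assms y
      by (simp add: coset_eq_iff a_minus_def M.smult_r_distr M.smult_r_minus)
  qed
  moreover have "H +>\<^bsub>M\<^esub> x \<noteq> {}" using assms H.a_rcos_self by blast
  ultimately have "(\<Union>y\<in>H +>\<^bsub>M\<^esub> x. H +>\<^bsub>M\<^esub> (a \<odot>\<^bsub>M\<^esub> y)) = H +>\<^bsub>M\<^esub> (a \<odot>\<^bsub>M\<^esub> x)"
    by (rule SUP_eq_const[rotated])
  then show ?thesis by (simp add: quot_mod_def)
qed

lemma module_quot_mod: "module R (quot_mod M H)"
proof -
  let ?Q = "quot_mod M H" and ?p = "\<lambda>x. H +>\<^bsub>M\<^esub> x"
  have Q: "carrier ?Q = ?p ` carrier M"
    by (auto simp: quot_mod_def A_RCOSETS_def')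
  note qs = quot_mod_add quot_mod_smult
  have zero: "\<zero>\<^bsub>?Q\<^esub> = ?p \<zero>\<^bsub>M\<^esub>"
    by (simp add: quot_mod_zero H.a_subset)
  have neg: "\<exists>D\<in>carrier ?Q. D \<oplus>\<^bsub>?Q\<^esub> C = \<zero>\<^bsub>?Q\<^esub>" if C: "C \<in> carrier ?Q" for C
  proof -
    obtain x where x: "x \<in> carrier M" "C = ?p x" using C by (rule quot_mod_carrierE)
    then have "?p (\<ominus>\<^bsub>M\<^esub> x) \<in> carrier ?Q" "?p (\<ominus>\<^bsub>M\<^esub> x) \<oplus>\<^bsub>?Q\<^esub> C = \<zero>\<^bsub>?Q\<^esub>"
      by (simp_all only: quot_mod_add quot_mod_memI zero M.M.l_neg M.M.a_inv_closed)
    then show ?thesis by blast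
  qed
  have "abelian_group ?Q"
  proof (rule abelian_groupI)
    show "C \<oplus>\<^bsub>?Q\<^esub> D = D \<oplus>\<^bsub>?Q\<^esub> C" if "C \<in> carrier ?Q" "D \<in> carrier ?Q" for C D
      using that M.M.a_comm by (auto simp only: Q qs)
  qed (use neg in \<open>auto simp only: Q zero qs M.M.a_closed M.M.zero_closed M.M.l_zero M.M.a_assoc\<close>)
  then show ?thesis
    by (rule moduleI[OF M.R.cring_axioms])
      (auto simp only: Q qs M.smult_closed M.M.a_closed M.smult_l_distr M.smult_r_distr M.smult_assoc1 M.smult_one
        M.R.a_closed M.R.m_closed M.R.one_closed)
qed

lemma is_linear_coset: "is_linear R M (quot_mod M H) (\<lambda>x. H +>\<^bsub>M\<^esub> x)"
  by (rule is_linearI) (simp_all add: quot_mod_memI quot_mod_add quot_mod_smult)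

lemma generates_quot_mod:
  assumes "generates R M S"
  shows "generates R (quot_mod M H) ((\<lambda>x. H +>\<^bsub>M\<^esub> x) ` S)"
  unfolding generates_def
proof (intro conjI allI impI)
  show "(\<lambda>x. H +>\<^bsub>M\<^esub> x) ` S \<subseteq> carrier (quot_mod M H)"
    using assms by (auto simp: generates_def intro: quot_mod_memI)
next
  fix K assume K: "submodule K R (quot_mod M H)" "(\<lambda>x. H +>\<^bsub>M\<^esub> x) ` S \<subseteq> K"
  have "carrier M \<subseteq> {x \<in> carrier M. H +>\<^bsub>M\<^esub> x \<in> K}"
    using submodule_vimage[OF M module_quot_mod is_linear_coset K(1)] assms K(2)
    unfolding generates_def by blast
  then show "carrier (quot_mod M H) \<subseteq> K" by (auto elim!: quot_mod_carrierE)
qed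

text \<open>\<open>g\<close> evaluates \<open>f\<close> at an arbitrarily chosen representative; the
  choice is immaterial because \<open>f\<close> kills differences in \<open>H\<close>.\<close>

lemma quot_mod_universal:
  assumes N: "module R N" and f: "is_linear R M N f" and 0: "\<And>x. x \<in> H \<Longrightarrow> f x = \<zero>\<^bsub>N\<^esub>"
  obtains g where "is_linear R (quot_mod M H) N g"
    "\<And>x. x \<in> carrier M \<Longrightarrow> g (H +>\<^bsub>M\<^esub> x) = f x"
proof -
  interpret N: module R N by fact
  note fD = is_linearD[OF f]
  define g where "g C = f (SOME x. x \<in> carrier M \<and> C = H +>\<^bsub>M\<^esub> x)" for C
  have g: "g (H +>\<^bsub>M\<^esub> x) = f x" if x: "x \<in> carrier M" for x
  proof -
    define y where "y = (SOME y. y \<in> carrier M \<and> H +>\<^bsub>M\<^esub> x = H +>\<^bsub>M\<^esub> y)"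
    have y: "y \<in> carrier M \<and> H +>\<^bsub>M\<^esub> x = H +>\<^bsub>M\<^esub> y"
      unfolding y_def by (rule someI[of _ x]) (use x in simp)
    then have "x \<ominus>\<^bsub>M\<^esub> y \<in> H" using x coset_eq_iff by blast
    then have "f x \<ominus>\<^bsub>N\<^esub> f y = \<zero>\<^bsub>N\<^esub>" using 0 is_linear_minus[OF M N f x] y by metis
    then have "f x = f y" using fD(1) x y
      by (metis N.M.add.inv_closed N.M.add.inv_equality N.M.add.inv_inv a_minus_def)
    then show ?thesis by (simp add: g_def y_def)
  qed
  have "is_linear R (quot_mod M H) N g"
    by (rule is_linearI)
      (auto elim!: quot_mod_carrierE simp: g fD quot_mod_add quot_mod_smult)
  with g show ?thesis using that by blast
qed

end

section \<open>Universal properties\<close>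

lemma free_mod_simps:
  "f \<in> carrier (free_mod R S) \<longleftrightarrow>
    (\<forall>x. f x \<in> carrier R) \<and> finite {x. f x \<noteq> \<zero>\<^bsub>R\<^esub>} \<and> {x. f x \<noteq> \<zero>\<^bsub>R\<^esub>} \<subseteq> S"
  "\<zero>\<^bsub>free_mod R S\<^esub> = (\<lambda>x. \<zero>\<^bsub>R\<^esub>)"
  "f \<oplus>\<^bsub>free_mod R S\<^esub> g = (\<lambda>x. f x \<oplus>\<^bsub>R\<^esub> g x)"
  "a \<odot>\<^bsub>free_mod R S\<^esub> f = (\<lambda>x. a \<otimes>\<^bsub>R\<^esub> f x)"
  by (auto simp: free_mod_def)

text \<open>\<open>F\<close> is any finite set containing the support. The support of a sum or a
  multiple may shrink, so a bound is easier to supply than the exact set.\<close>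

lemma free_mod_memI:
  assumes "\<And>x. f x \<in> carrier R" "finite F" "\<And>x. x \<notin> F \<Longrightarrow> f x = \<zero>\<^bsub>R\<^esub>" "F \<subseteq> S"
  shows "f \<in> carrier (free_mod R S)"
proof -
  have "{x. f x \<noteq> \<zero>\<^bsub>R\<^esub>} \<subseteq> F" using assms(3) by blast
  then show ?thesis using assms(1,2,4) by (auto simp: free_mod_simps intro: finite_subset)
qed

lemma module_free_mod:
  assumes "cring R"
  shows "module R (free_mod R S)"
proof -
  interpret R: cring R by fact
  let ?F = "free_mod R S"
  have closed: "f \<oplus>\<^bsub>?F\<^esub> g \<in> carrier ?F" if f: "f \<in> carrier ?F" and g: "g \<in> carrier ?F" for f g
    by (rule free_mod_memI[of _ _ "{x. f x \<noteq> \<zero>\<^bsub>R\<^esub>} \<union> {x. g x \<noteq> \<zero>\<^bsub>R\<^esub>}"])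
      (use f g in \<open>auto simp: free_mod_simps\<close>)
  have smult: "a \<odot>\<^bsub>?F\<^esub> f \<in> carrier ?F" if a: "a \<in> carrier R" and f: "f \<in> carrier ?F" for a f
    by (rule free_mod_memI[of _ _ "{x. f x \<noteq> \<zero>\<^bsub>R\<^esub>}"])
      (use f a in \<open>auto simp: free_mod_simps\<close>)
  have neg: "\<exists>g\<in>carrier ?F. g \<oplus>\<^bsub>?F\<^esub> f = \<zero>\<^bsub>?F\<^esub>" if f: "f \<in> carrier ?F" for f
    using smult[of "\<ominus>\<^bsub>R\<^esub> \<one>\<^bsub>R\<^esub>", OF _ f] f
    by (intro bexI[of _ "(\<ominus>\<^bsub>R\<^esub> \<one>\<^bsub>R\<^esub>) \<odot>\<^bsub>?F\<^esub> f"])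
      (auto simp: free_mod_simps R.l_minus R.l_neg)
  have "abelian_group ?F"
    by (rule abelian_groupI)
      (use closed neg in \<open>auto simp: free_mod_simps R.a_ac\<close>)
  then show ?thesis
    by (rule moduleI[OF assms])
      (use smult in \<open>auto simp: free_mod_simps R.l_distr R.r_distr R.m_assoc\<close>)
qed

lemma free_gen_mem:
  assumes "cring R" "x \<in> S"
  shows "free_gen R x \<in> carrier (free_mod R S)"
proof -
  interpret R: cring R by fact
  show ?thesis
    by (rule free_mod_memI[of _ _ "{x}"]) (use assms(2) in \<open>auto simp: free_gen_def\<close>)
qed

text \<open>Induction on a finite set containing the support: setting the coefficient at
  \<open>x\<close> to zero leaves a function supported on the smaller set, and what was removed is a
  multiple of one generator.\<close>

lemma generates_free_gen:
  assumes "cring R"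
  shows "generates R (free_mod R S) (free_gen R ` S)"
  unfolding generates_def
proof (intro conjI allI impI subsetI)
  interpret R: cring R by fact
  let ?F = "free_mod R S"
  have F: "module R ?F" by (rule module_free_mod[OF assms])
  fix f H assume H: "submodule H R ?F" "free_gen R ` S \<subseteq> H" and f: "f \<in> carrier ?F"
  have "f \<in> H" if "finite E" "f \<in> carrier ?F" "{x. f x \<noteq> \<zero>\<^bsub>R\<^esub>} \<subseteq> E" for E f
    using that
  proof (induction E arbitrary: f rule: finite_induct)
    case empty
    then have "f = \<zero>\<^bsub>?F\<^esub>" by (auto simp: free_mod_simps)
    then show ?case using submodule_memD(2)[OF F H(1)] by simp
  next
    case (insert x E)
    have fR: "f y \<in> carrier R" for y using insert.prems by (simp add: free_mod_simps)
    let ?g = "f(x := \<zero>\<^bsub>R\<^esub>)"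
    have g: "?g \<in> carrier ?F"
      by (rule free_mod_memI[of _ _ "{x. f x \<noteq> \<zero>\<^bsub>R\<^esub>}"])
        (use insert.prems in \<open>auto simp: free_mod_simps\<close>)
    have gH: "?g \<in> H" by (rule insert.IH[OF g]) (use insert.prems in auto)
    show ?case
    proof (cases "f x = \<zero>\<^bsub>R\<^esub>")
      case True
      then have "?g = f" by auto
      then show ?thesis using gH by metis
    next
      case False
      then have "free_gen R x \<in> H" using insert.prems H(2) unfolding free_mod_simps by blast
      then have "?g \<oplus>\<^bsub>?F\<^esub> f x \<odot>\<^bsub>?F\<^esub> free_gen R x \<in> H"
        using submodule_memD(3,5)[OF F H(1)] gH fR by blast
      moreover have "?g \<oplus>\<^bsub>?F\<^esub> f x \<odot>\<^bsub>?F\<^esub> free_gen R x = f"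
        using fR by (auto simp: free_mod_simps free_gen_def)
      ultimately show ?thesis by simp
    qed
  qed
  then show "f \<in> H" using f by (auto simp: free_mod_simps)
qed (use free_gen_mem[OF assms] in auto)

lemma free_mod_universal:
  assumes N: "module R N" and v: "\<And>x. x \<in> S \<Longrightarrow> v x \<in> carrier N"
  obtains g where "is_linear R (free_mod R S) N g" "\<And>x. x \<in> S \<Longrightarrow> g (free_gen R x) = v x"
proof -
  interpret N: module R N by fact
  let ?F = "free_mod R S"
  define g where "g f = (\<Oplus>\<^bsub>N\<^esub>x\<in>{x. f x \<noteq> \<zero>\<^bsub>R\<^esub>}. f x \<odot>\<^bsub>N\<^esub> v x)" for f
  \<comment> \<open>Supports vary with the function, so additivity needs sums over a common index
    set; the terms added outside the support are zero.\<close>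
  have g: "g f = (\<Oplus>\<^bsub>N\<^esub>x\<in>E. f x \<odot>\<^bsub>N\<^esub> v x)"
    if "f \<in> carrier ?F" "finite E" "{x. f x \<noteq> \<zero>\<^bsub>R\<^esub>} \<subseteq> E" "E \<subseteq> S" for f E
    unfolding g_def
    by (rule N.add.finprod_mono_neutral_cong_left)
      (use that v in \<open>auto simp: free_mod_simps\<close>)
  have "is_linear R ?F N g"
  proof (rule is_linearI)
    show "g f \<in> carrier N" if "f \<in> carrier ?F" for f
      unfolding g_def by (rule N.M.finsum_closed) (use that v in \<open>auto simp: free_mod_simps\<close>)
    show "g (a \<odot>\<^bsub>?F\<^esub> f) = a \<odot>\<^bsub>N\<^esub> g f" if a: "a \<in> carrier R" and f: "f \<in> carrier ?F" for a f
    proof -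
      interpret F: module R ?F by (rule module_free_mod[OF N.R.cring_axioms])
      let ?E = "{x. f x \<noteq> \<zero>\<^bsub>R\<^esub>}"
      have E: "finite ?E" "?E \<subseteq> S" and fR: "\<And>x. f x \<in> carrier R"
        using f by (auto simp: free_mod_simps)
      have "g (a \<odot>\<^bsub>?F\<^esub> f) = (\<Oplus>\<^bsub>N\<^esub>x\<in>?E. (a \<odot>\<^bsub>?F\<^esub> f) x \<odot>\<^bsub>N\<^esub> v x)"
        by (rule g) (use a f E in \<open>auto simp: free_mod_simps(4) intro: F.smult_closed[of a f, unfolded free_mod_simps(4)]\<close>)
      also have "\<dots> = (\<Oplus>\<^bsub>N\<^esub>x\<in>?E. a \<odot>\<^bsub>N\<^esub> (f x \<odot>\<^bsub>N\<^esub> v x))"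
        by (rule N.M.finsum_cong') (use a E fR v in \<open>auto simp: free_mod_simps N.smult_assoc1\<close>)
      also have "\<dots> = a \<odot>\<^bsub>N\<^esub> g f"
        unfolding g_def by (rule N.finsum_smult_ldistr[symmetric]) (use a E fR v in auto)
      finally show ?thesis .
    qed
    show "g (f \<oplus>\<^bsub>?F\<^esub> h) = g f \<oplus>\<^bsub>N\<^esub> g h" if f: "f \<in> carrier ?F" and h: "h \<in> carrier ?F" for f h
    proof -
      interpret F: module R ?F by (rule module_free_mod[OF N.R.cring_axioms])
      let ?E = "{x. f x \<noteq> \<zero>\<^bsub>R\<^esub>} \<union> {x. h x \<noteq> \<zero>\<^bsub>R\<^esub>}"
      have E: "finite ?E" "?E \<subseteq> S" and fR: "\<And>x. f x \<in> carrier R" "\<And>x. h x \<in> carrier R"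
        using f h by (auto simp: free_mod_simps)
      have "g (f \<oplus>\<^bsub>?F\<^esub> h) = (\<Oplus>\<^bsub>N\<^esub>x\<in>?E. (f \<oplus>\<^bsub>?F\<^esub> h) x \<odot>\<^bsub>N\<^esub> v x)"
        by (rule g) (use f h E in \<open>auto simp: free_mod_simps(3) intro: F.M.a_closed[of f h, unfolded free_mod_simps(3)]\<close>)
      also have "\<dots> = (\<Oplus>\<^bsub>N\<^esub>x\<in>?E. f x \<odot>\<^bsub>N\<^esub> v x \<oplus>\<^bsub>N\<^esub> h x \<odot>\<^bsub>N\<^esub> v x)"
        by (rule N.M.finsum_cong') (use E fR v in \<open>auto simp: free_mod_simps(3) N.smult_l_distr\<close>)
      also have "\<dots> = (\<Oplus>\<^bsub>N\<^esub>x\<in>?E. f x \<odot>\<^bsub>N\<^esub> v x) \<oplus>\<^bsub>N\<^esub> (\<Oplus>\<^bsub>N\<^esub>x\<in>?E. h x \<odot>\<^bsub>N\<^esub> v x)"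
        by (rule N.M.finsum_addf) (use E fR v in auto)
      also have "\<dots> = g f \<oplus>\<^bsub>N\<^esub> g h"
        using g[OF f E(1) _ E(2)] g[OF h E(1) _ E(2)] by auto
      finally show ?thesis .
    qed
  qed
  moreover have "g (free_gen R x) = v x" if x: "x \<in> S" for x
  proof -
    have "g (free_gen R x) = (\<Oplus>\<^bsub>N\<^esub>y\<in>{x}. free_gen R x y \<odot>\<^bsub>N\<^esub> v y)"
      by (rule g[OF free_gen_mem[OF N.R.cring_axioms x]]) (use x in \<open>auto simp: free_gen_def\<close>)
    then show ?thesis using v[OF x] by (simp add: free_gen_def)
  qed
  ultimately show ?thesis using that by blast
qed

text \<open>Stated with list updates so that the two conditions mirror the two families of
  \<open>tensor_rels\<close>; the linear extension of a multilinear map to the free module then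
  kills the relations.\<close>

definition multilin ::
  "('r, 'k) ring_scheme \<Rightarrow> ('r, 'm, 'u) module_scheme \<Rightarrow> nat \<Rightarrow> ('r, 'n, 'v) module_scheme \<Rightarrow> ('m list \<Rightarrow> 'n) \<Rightarrow> bool"
  where "multilin R M n N f \<longleftrightarrow>
    (\<forall>xs\<in>tuples M n. f xs \<in> carrier N) \<and>
    (\<forall>xs\<in>tuples M n. \<forall>i<n. \<forall>x\<in>carrier M. \<forall>y\<in>carrier M.
       f (xs[i := x \<oplus>\<^bsub>M\<^esub> y]) = f (xs[i := x]) \<oplus>\<^bsub>N\<^esub> f (xs[i := y])) \<and>
    (\<forall>xs\<in>tuples M n. \<forall>i<n. \<forall>a\<in>carrier R. \<forall>x\<in>carrier M.
       f (xs[i := a \<odot>\<^bsub>M\<^esub> x]) = a \<odot>\<^bsub>N\<^esub> f (xs[i := x]))"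

lemma multilinD:
  assumes "multilin R M n N f" "xs \<in> tuples M n"
  shows "f xs \<in> carrier N"
    and "i < n \<Longrightarrow> x \<in> carrier M \<Longrightarrow> y \<in> carrier M \<Longrightarrow>
      f (xs[i := x \<oplus>\<^bsub>M\<^esub> y]) = f (xs[i := x]) \<oplus>\<^bsub>N\<^esub> f (xs[i := y])"
    and "i < n \<Longrightarrow> a \<in> carrier R \<Longrightarrow> x \<in> carrier M \<Longrightarrow>
      f (xs[i := a \<odot>\<^bsub>M\<^esub> x]) = a \<odot>\<^bsub>N\<^esub> f (xs[i := x])"
  using assms by (auto simp: multilin_def)

lemma tuples_update: "xs \<in> tuples M n \<Longrightarrow> x \<in> carrier M \<Longrightarrow> xs[i := x] \<in> tuples M n"
  using set_update_subset_insert[of xs i x] by (auto simp: tuples_def)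

lemma multilin_compose:
  assumes "multilin R M n N f" "is_linear R N P g"
  shows "multilin R M n P (\<lambda>xs. g (f xs))"
  using assms(1) is_linearD[OF assms(2)]
  by (auto simp: multilin_def tuples_update)

lemma tuples_2_iff: "[x, y] \<in> tuples M 2 \<longleftrightarrow> x \<in> carrier M \<and> y \<in> carrier M"
  by (auto simp: tuples_def)

lemma tuples_3_iff: "[x, y, z] \<in> tuples M 3 \<longleftrightarrow> x \<in> carrier M \<and> y \<in> carrier M \<and> z \<in> carrier M"
  by (auto simp: tuples_def)

lemma tuples_4_iff: "[x, y, z, t] \<in> tuples M 4 \<longleftrightarrow> x \<in> carrier M \<and> y \<in> carrier M \<and> z \<in> carrier M \<and> t \<in> carrier M"
  by (auto simp: tuples_def)

text \<open>\<open>finsum\<close> over an infinite set is the zero element by default, so in that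
  case the map is constantly zero and still linear.\<close>

lemma is_linear_finsum_fun:
  assumes N: "module R N" and f: "\<And>i. i \<in> I \<Longrightarrow> is_linear R M N (f i)"
  shows "is_linear R M N (\<lambda>x. \<Oplus>\<^bsub>N\<^esub>i\<in>I. f i x)"
proof -
  interpret N: module R N by fact
  note fD = is_linearD[OF f]
  show ?thesis
  proof (cases "finite I")
    case True
    show ?thesis
    proof (rule is_linearI)
      show "(\<Oplus>\<^bsub>N\<^esub>i\<in>I. f i x) \<in> carrier N" if "x \<in> carrier M" for x
        using fD that by (intro N.M.finsum_closed) auto
      show "(\<Oplus>\<^bsub>N\<^esub>i\<in>I. f i (x \<oplus>\<^bsub>M\<^esub> y)) = (\<Oplus>\<^bsub>N\<^esub>i\<in>I. f i x) \<oplus>\<^bsub>N\<^esub> (\<Oplus>\<^bsub>N\<^esub>i\<in>I. f i y)"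
        if "x \<in> carrier M" "y \<in> carrier M" for x y
      proof -
        have "(\<Oplus>\<^bsub>N\<^esub>i\<in>I. f i (x \<oplus>\<^bsub>M\<^esub> y)) = (\<Oplus>\<^bsub>N\<^esub>i\<in>I. f i x \<oplus>\<^bsub>N\<^esub> f i y)"
          using fD that by (intro N.M.finsum_cong') auto
        also have "\<dots> = (\<Oplus>\<^bsub>N\<^esub>i\<in>I. f i x) \<oplus>\<^bsub>N\<^esub> (\<Oplus>\<^bsub>N\<^esub>i\<in>I. f i y)"
          using fD that by (intro N.M.finsum_addf) auto
        finally show ?thesis .
      qed
      show "(\<Oplus>\<^bsub>N\<^esub>i\<in>I. f i (a \<odot>\<^bsub>M\<^esub> x)) = a \<odot>\<^bsub>N\<^esub> (\<Oplus>\<^bsub>N\<^esub>i\<in>I. f i x)"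
        if "a \<in> carrier R" "x \<in> carrier M" for a x
        using fD that True by (subst N.finsum_smult_ldistr) (auto intro!: N.M.finsum_cong')
    qed
  qed (use is_linear_const_zero[OF N] in simp)
qed

lemma is_linear_ident: "is_linear R M M (\<lambda>x. x)"
  by (simp add: is_linear_def)

lemma is_linear_uminus:
  assumes "module R N" "is_linear R M N f"
  shows "is_linear R M N (\<lambda>x. \<ominus>\<^bsub>N\<^esub> f x)"
proof -
  interpret N: module R N by fact
  note f = is_linearD[OF assms(2)]
  show ?thesis
    by (rule is_linearI) (simp_all add: f N.M.minus_add N.smult_r_minus)
qed

lemma is_linear_diff:
  assumes "module R N" "is_linear R M N f" "is_linear R M N g"
  shows "is_linear R M N (\<lambda>x. f x \<ominus>\<^bsub>N\<^esub> g x)"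
  unfolding a_minus_def using assms by (intro is_linear_add is_linear_uminus)

lemma multilinI:
  assumes "\<And>xs. xs \<in> tuples M n \<Longrightarrow> f xs \<in> carrier N"
    and "\<And>xs i. xs \<in> tuples M n \<Longrightarrow> i < n \<Longrightarrow> is_linear R M N (\<lambda>x. f (xs[i := x]))"
  shows "multilin R M n N f"
  using assms(1) is_linearD(2,3)[OF assms(2)] unfolding multilin_def by auto

lemma multilin_is_linear:
  assumes "multilin R M n N f" "xs \<in> tuples M n" "i < n"
  shows "is_linear R M N (\<lambda>x. f (xs[i := x]))"
  using multilinD[OF assms(1)] assms(2,3) by (intro is_linearI) (auto simp: tuples_update)

text \<open>The varying entry may itself be a linear image \<open>g x\<close>, as in a wedge with a
  bracket among its factors.\<close>

lemma multilin_is_linear_append: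
  assumes "multilin R M n N f" "set us \<subseteq> carrier M" "set vs \<subseteq> carrier M"
    and "n = Suc (length us + length vs)" "is_linear R P M g" "module R P"
  shows "is_linear R P N (\<lambda>x. f (us @ g x # vs))"
proof -
  interpret P: module R P by fact
  \<comment> \<open>The entry in position \<open>length us\<close> is a placeholder that the update
    overwrites; it only has to make the list a tuple.\<close>
  let ?xs = "us @ g \<zero>\<^bsub>P\<^esub> # vs"
  have "?xs \<in> tuples M n"
    using assms(2-4) is_linearD(1)[OF assms(5)] by (auto simp: tuples_def)
  from is_linear_compose[OF assms(5) multilin_is_linear[OF assms(1) this, of "length us"]] assms(4)
  show ?thesis by simp
qed

lemma multilin_3I:
  assumes "\<And>x y z. x \<in> carrier M \<Longrightarrow> y \<in> carrier M \<Longrightarrow> z \<in> carrier M \<Longrightarrow> f x y z \<in> carrier N"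
    and "\<And>y z. y \<in> carrier M \<Longrightarrow> z \<in> carrier M \<Longrightarrow> is_linear R M N (\<lambda>x. f x y z)"
    and "\<And>x z. x \<in> carrier M \<Longrightarrow> z \<in> carrier M \<Longrightarrow> is_linear R M N (\<lambda>y. f x y z)"
    and "\<And>x y. x \<in> carrier M \<Longrightarrow> y \<in> carrier M \<Longrightarrow> is_linear R M N (f x y)"
  shows "multilin R M 3 N (\<lambda>xs. f (xs ! 0) (xs ! 1) (xs ! 2))"
proof (rule multilinI)
  fix xs assume "xs \<in> tuples M 3"
  then obtain x y z where xs: "xs = [x, y, z]" "x \<in> carrier M" "y \<in> carrier M" "z \<in> carrier M"
    by (auto simp: tuples_def length_Suc_conv eval_nat_numeral)
  show "f (xs ! 0) (xs ! 1) (xs ! 2) \<in> carrier N" using xs assms(1) by simp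
  fix i :: nat assume "i < 3"
  then consider "i = 0" | "i = 1" | "i = 2" by linarith
  then show "is_linear R M N (\<lambda>u. f (xs[i := u] ! 0) (xs[i := u] ! 1) (xs[i := u] ! 2))"
    using xs assms(2-4) by cases auto
qed

text \<open>Bridges two index sets: the Killing relations and the Koszul map are specified on
  triples, generation is known for lists of length 3.\<close>

lemma tuples_3_image: "(\<lambda>(x, y, z). f [x, y, z]) ` (carrier M \<times> carrier M \<times> carrier M) = f ` tuples M 3"
proof -
  have "tuples M 3 = (\<lambda>(x, y, z). [x, y, z]) ` (carrier M \<times> carrier M \<times> carrier M)"
    by (force simp: tuples_def length_Suc_conv eval_nat_numeral)
  then show ?thesis by (simp add: image_image case_prod_unfold)
qed

section \<open>Tensor powers, exterior powers and the symmetric square\<close>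

context
  fixes R :: "('r, 'k) ring_scheme" and M :: "('r, 'm, 'u) module_scheme"
  assumes M: "module R M"
begin

interpretation M: module R M by (fact M)

lemma module_free_tuples: "module R (free_mod R (tuples M n))"
  by (rule module_free_mod[OF M.R.cring_axioms])

lemma tensor_rels_subset: "tensor_rels R M n \<subseteq> carrier (free_mod R (tuples M n))"
proof -
  interpret F: module R "free_mod R (tuples M n)" by (rule module_free_tuples)
  have "free_gen R (xs[i := x]) \<in> carrier (free_mod R (tuples M n))"
    if "xs \<in> tuples M n" "x \<in> carrier M" for xs i x
    by (rule free_gen_mem[OF M.R.cring_axioms tuples_update[OF that]])
  then show ?thesis by (auto simp: tensor_rels_def Let_def)
qed

lemma submodule_tensor_rels:
  "submodule (submod_span R (free_mod R (tuples M n)) (tensor_rels R M n)) R (free_mod R (tuples M n))"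
  by (rule submodule_submod_span[OF module_free_tuples tensor_rels_subset])

lemma module_tensor_power: "module R (tensor_power R M n)"
  unfolding tensor_power_def by (rule module_quot_mod[OF module_free_tuples submodule_tensor_rels])

lemma tensor_eq:
  "xs \<in> tuples M n \<Longrightarrow> tensor R M xs =
    submod_span R (free_mod R (tuples M n)) (tensor_rels R M n) +>\<^bsub>free_mod R (tuples M n)\<^esub> free_gen R xs"
  by (simp add: tensor_def tuples_def)

lemma generates_tensor: "generates R (tensor_power R M n) (tensor R M ` tuples M n)"
proof -
  have "tensor R M ` tuples M n =
      (\<lambda>x. submod_span R (free_mod R (tuples M n)) (tensor_rels R M n) +>\<^bsub>free_mod R (tuples M n)\<^esub> x)
        ` free_gen R ` tuples M n"
    by (auto simp: tensor_eq[of _ n] image_image)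
  then show ?thesis
    using generates_quot_mod[OF module_free_tuples submodule_tensor_rels
        generates_free_gen[OF M.R.cring_axioms], of n]
    by (simp add: tensor_power_def)
qed

lemma multilin_tensor: "multilin R M n (tensor_power R M n) (tensor R M)"
proof -
  let ?F = "free_mod R (tuples M n)" let ?T = "submod_span R ?F (tensor_rels R M n)"
  interpret F: module R ?F by (rule module_free_tuples)
  note T = module_free_tuples[of n] submodule_tensor_rels[of n]
  have d: "free_gen R xs \<in> carrier ?F" if "xs \<in> tuples M n" for xs
    by (rule free_gen_mem[OF M.R.cring_axioms that])
  show ?thesis unfolding multilin_def
  proof (intro conjI ballI allI impI)
    fix xs assume xs: "xs \<in> tuples M n"
    then show "tensor R M xs \<in> carrier (tensor_power R M n)"
      using generates_tensor by (auto simp: generates_def)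
    fix i assume i: "i < n"
    fix x assume x: "x \<in> carrier M"
    note u = tuples_update[OF xs]
    { fix y assume y: "y \<in> carrier M"
      have "free_gen R (xs[i := x \<oplus>\<^bsub>M\<^esub> y]) \<ominus>\<^bsub>?F\<^esub> (free_gen R (xs[i := x]) \<oplus>\<^bsub>?F\<^esub> free_gen R (xs[i := y])) \<in> ?T"
        by (rule subsetD[OF submod_span_incl]) (use xs i x y in \<open>auto simp: tensor_rels_def Let_def\<close>)
      then show "tensor R M (xs[i := x \<oplus>\<^bsub>M\<^esub> y]) =
          tensor R M (xs[i := x]) \<oplus>\<^bsub>tensor_power R M n\<^esub> tensor R M (xs[i := y])"
        using x y coset_eq_iff[OF T] d u
        by (simp add: tensor_eq[of _ n] u tensor_power_def quot_mod_add[OF T]) }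
    { fix a assume a: "a \<in> carrier R"
      have "free_gen R (xs[i := a \<odot>\<^bsub>M\<^esub> x]) \<ominus>\<^bsub>?F\<^esub> a \<odot>\<^bsub>?F\<^esub> free_gen R (xs[i := x]) \<in> ?T"
        by (rule subsetD[OF submod_span_incl]) (use xs i x a in \<open>auto simp: tensor_rels_def Let_def\<close>)
      then show "tensor R M (xs[i := a \<odot>\<^bsub>M\<^esub> x]) = a \<odot>\<^bsub>tensor_power R M n\<^esub> tensor R M (xs[i := x])"
        using x a coset_eq_iff[OF T] d u
        by (simp add: tensor_eq[of _ n] u tensor_power_def quot_mod_smult[OF T]) }
  qed
qed

lemma tensor_power_universal:
  assumes N: "module R N" and f: "multilin R M n N f"
  obtains g where "is_linear R (tensor_power R M n) N g"
    "\<And>xs. xs \<in> tuples M n \<Longrightarrow> g (tensor R M xs) = f xs"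
proof -
  let ?F = "free_mod R (tuples M n)" let ?T = "submod_span R ?F (tensor_rels R M n)"
  interpret F: module R ?F by (rule module_free_tuples)
  interpret N: module R N by fact
  note T = module_free_tuples[of n] submodule_tensor_rels[of n]
  note fD = multilinD[OF f]
  have d: "free_gen R xs \<in> carrier ?F" if "xs \<in> tuples M n" for xs
    by (rule free_gen_mem[OF M.R.cring_axioms that])
  obtain h where h: "is_linear R ?F N h" "\<And>xs. xs \<in> tuples M n \<Longrightarrow> h (free_gen R xs) = f xs"
    using free_mod_universal[OF N, of "tuples M n" f] fD(1) by blast
  note hm = is_linear_minus[OF T(1) N h(1)] is_linearD[OF h(1)]
  have "tensor_rels R M n \<subseteq> {x \<in> carrier ?F. h x = \<zero>\<^bsub>N\<^esub>}"
    using fD(1)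
    by (auto simp: tensor_rels_def Let_def d tuples_update hm h(2) fD(2,3) N.M.r_neg N.M.minus_eq F.M.minus_closed)
  then have "?T \<subseteq> {x \<in> carrier ?F. h x = \<zero>\<^bsub>N\<^esub>}"
    by (rule submod_span_least[OF submodule_kernel[OF T(1) N h(1)]])
  then obtain g where "is_linear R (quot_mod ?F ?T) N g"
      "\<And>x. x \<in> carrier ?F \<Longrightarrow> g (?T +>\<^bsub>?F\<^esub> x) = h x"
    using quot_mod_universal[OF T N h(1)] by blast
  then show ?thesis using that[of g] h(2) d by (simp add: tensor_power_def tensor_eq[of _ n])
qed

lemma tensor_mem: "xs \<in> tuples M n \<Longrightarrow> tensor R M xs \<in> carrier (tensor_power R M n)"
  by (rule multilinD(1)[OF multilin_tensor])

lemma submodule_ext_kernel: "submodule (ext_kernel R M n) R (tensor_power R M n)"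
  unfolding ext_kernel_def
  by (rule submodule_submod_span[OF module_tensor_power]) (auto intro: tensor_mem)

lemma module_ext_power: "module R (ext_power R M n)"
  unfolding ext_power_def by (rule module_quot_mod[OF module_tensor_power submodule_ext_kernel])

lemma wedge_eq:
  "xs \<in> tuples M n \<Longrightarrow> wedge R M xs = ext_kernel R M n +>\<^bsub>tensor_power R M n\<^esub> tensor R M xs"
  by (simp add: wedge_def tuples_def)

lemma generates_wedge: "generates R (ext_power R M n) (wedge R M ` tuples M n)"
proof -
  have "wedge R M ` tuples M n =
      (\<lambda>x. ext_kernel R M n +>\<^bsub>tensor_power R M n\<^esub> x) ` tensor R M ` tuples M n"
    by (auto simp: wedge_eq[of _ n] image_image)
  then show ?thesis
    using generates_quot_mod[OF module_tensor_power submodule_ext_kernel generates_tensor, of n]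
    by (simp add: ext_power_def)
qed

lemma multilin_wedge: "multilin R M n (ext_power R M n) (wedge R M)"
proof -
  have "multilin R M n (ext_power R M n)
      (\<lambda>xs. ext_kernel R M n +>\<^bsub>tensor_power R M n\<^esub> tensor R M xs)"
    unfolding ext_power_def
    by (rule multilin_compose[OF multilin_tensor is_linear_coset[OF module_tensor_power submodule_ext_kernel]])
  then show ?thesis by (simp add: multilin_def wedge_eq[of _ n] tuples_update)
qed

lemma wedge_not_distinct:
  assumes "xs \<in> tuples M n" "\<not> distinct xs"
  shows "wedge R M xs = \<zero>\<^bsub>ext_power R M n\<^esub>"
proof -
  have "tensor R M xs \<in> ext_kernel R M n"
    unfolding ext_kernel_def by (rule subsetD[OF submod_span_incl]) (use assms in auto)
  then show ?thesis
    using coset_zero_iff[OF module_tensor_power submodule_ext_kernel] tensor_mem assms(1)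
    by (simp add: wedge_eq[of _ n] ext_power_def quot_mod_zero)
qed

text \<open>\<open>alt\<close> covers a repetition in any two positions, matching
  \<open>ext_kernel\<close>, which is spanned by all tensors with a repeated entry. The linear map
  induced on the tensor power kills these and hence their span.\<close>

lemma ext_power_universal:
  assumes N: "module R N" and f: "multilin R M n N f"
    and alt: "\<And>xs. xs \<in> tuples M n \<Longrightarrow> \<not> distinct xs \<Longrightarrow> f xs = \<zero>\<^bsub>N\<^esub>"
  obtains g where "is_linear R (ext_power R M n) N g"
    "\<And>xs. xs \<in> tuples M n \<Longrightarrow> g (wedge R M xs) = f xs"
proof -
  note T = module_tensor_power[of n] submodule_ext_kernel[of n]
  obtain h where h: "is_linear R (tensor_power R M n) N h"
      "\<And>xs. xs \<in> tuples M n \<Longrightarrow> h (tensor R M xs) = f xs"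
    using tensor_power_universal[OF N f] by blast
  have "ext_kernel R M n \<subseteq> {x \<in> carrier (tensor_power R M n). h x = \<zero>\<^bsub>N\<^esub>}"
    unfolding ext_kernel_def
    by (rule submod_span_least[OF submodule_kernel[OF T(1) N h(1)]])
      (auto simp: h(2) alt tensor_mem)
  then obtain g where "is_linear R (quot_mod (tensor_power R M n) (ext_kernel R M n)) N g"
      "\<And>x. x \<in> carrier (tensor_power R M n) \<Longrightarrow> g (ext_kernel R M n +>\<^bsub>tensor_power R M n\<^esub> x) = h x"
    using quot_mod_universal[OF T N h(1)] by blast
  then show ?thesis using that[of g] h(2) tensor_mem by (simp add: ext_power_def wedge_eq[of _ n])
qed

lemma submodule_sym_kernel: "submodule (sym_kernel R M) R (tensor_power R M 2)"
proof -
  interpret T: module R "tensor_power R M 2" by (rule module_tensor_power)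
  show ?thesis unfolding sym_kernel_def
    by (rule submodule_submod_span[OF module_tensor_power])
      (auto intro!: T.M.minus_closed tensor_mem simp: tuples_2_iff)
qed

lemma module_sym_square: "module R (sym_square R M)"
  unfolding sym_square_def by (rule module_quot_mod[OF module_tensor_power submodule_sym_kernel])

lemma multilin_sym: "multilin R M 2 (sym_square R M) (\<lambda>xs. sym_kernel R M +>\<^bsub>tensor_power R M 2\<^esub> tensor R M xs)"
  unfolding sym_square_def
  by (rule multilin_compose[OF multilin_tensor is_linear_coset[OF module_tensor_power submodule_sym_kernel]])

lemma sym_prod_closed:
  "x \<in> carrier M \<Longrightarrow> y \<in> carrier M \<Longrightarrow> sym_prod R M x y \<in> carrier (sym_square R M)"
  using multilinD(1)[OF multilin_sym, of "[x, y]"] by (simp add: sym_prod_def tuples_2_iff)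

lemma sym_prod_add_left:
  "x \<in> carrier M \<Longrightarrow> y \<in> carrier M \<Longrightarrow> z \<in> carrier M \<Longrightarrow>
    sym_prod R M (x \<oplus>\<^bsub>M\<^esub> y) z = sym_prod R M x z \<oplus>\<^bsub>sym_square R M\<^esub> sym_prod R M y z"
  using multilinD(2)[OF multilin_sym, of "[x, z]" 0 x y] by (simp add: sym_prod_def tuples_2_iff)

lemma sym_prod_smult_left:
  "a \<in> carrier R \<Longrightarrow> x \<in> carrier M \<Longrightarrow> y \<in> carrier M \<Longrightarrow>
    sym_prod R M (a \<odot>\<^bsub>M\<^esub> x) y = a \<odot>\<^bsub>sym_square R M\<^esub> sym_prod R M x y"
  using multilinD(3)[OF multilin_sym, of "[x, y]" 0 a x] by (simp add: sym_prod_def tuples_2_iff)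

lemma sym_prod_commute:
  assumes "x \<in> carrier M" "y \<in> carrier M"
  shows "sym_prod R M x y = sym_prod R M y x"
proof -
  have "tensor R M [x, y] \<ominus>\<^bsub>tensor_power R M 2\<^esub> tensor R M [y, x] \<in> sym_kernel R M"
    unfolding sym_kernel_def by (rule subsetD[OF submod_span_incl]) (use assms in auto)
  then show ?thesis
    using coset_eq_iff[OF module_tensor_power submodule_sym_kernel] tensor_mem assms
    by (simp add: sym_prod_def tuples_2_iff)
qed

end

section \<open>The Chevalley--Eilenberg differential\<close>

text \<open>When one entry of \<open>xs\<close> varies, it either disappears from the selected
  entries or keeps one fixed place among them. The point is that \<open>us\<close> and
  \<open>vs\<close> do not depend on \<open>x\<close>, so linearity in \<open>x\<close> can be read
  off.\<close>

lemma nths_list_update: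
  assumes "p < length xs"
  obtains us vs where "\<And>x. nths (xs[p := x]) B = us @ (if p \<in> B then [x] else []) @ vs"
    "set us \<subseteq> set xs" "set vs \<subseteq> set xs"
\<comment> \<open>Dropping \<open>Suc p\<close> entries shifts positions, so the selection set for
  the rest is \<open>B\<close> moved down by \<open>Suc p\<close>.\<close>
proof (rule that[of "nths (take p xs) B" "nths (drop (Suc p) xs) {j. Suc (j + p) \<in> B}"])
  show "nths (xs[p := x]) B = nths (take p xs) B @ (if p \<in> B then [x] else []) @ nths (drop (Suc p) xs) {j. Suc (j + p) \<in> B}" for x
    using assms by (simp add: upd_conv_take_nth_drop nths_append nths_Cons min_def)
qed (auto dest!: in_set_nthsD in_set_takeD in_set_dropD)

lemma length_nths_compl_pair:
  assumes "i < j" "j < length xs"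
  shows "length (nths xs (- {i, j})) = length xs - 2"
proof -
  have "{k. k < length xs \<and> k \<in> - {i, j}} = {..<length xs} - {i, j}" by auto
  then show ?thesis using assms by (simp add: length_nths card_Diff_subset)
qed

lemma (in abelian_group) finsum_triangle_3:
  fixes f :: "nat \<Rightarrow> nat \<Rightarrow> 'a"
  assumes "\<And>i j. i < j \<Longrightarrow> j < 3 \<Longrightarrow> f i j \<in> carrier G"
  shows "(\<Oplus>j\<in>{..<3}. \<Oplus>i\<in>{..<j}. f i j) = f 0 1 \<oplus> (f 0 2 \<oplus> f 1 2)"
proof -
  have "{..<3::nat} = {2, 1, 0}" "{..<2::nat} = {1, 0}" "{..<Suc 0} = {0}" by auto
  then show ?thesis using assms by (simp add: a_ac)
qed

lemma (in abelian_group) finsum_triangle_4: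
  fixes f :: "nat \<Rightarrow> nat \<Rightarrow> 'a"
  assumes "\<And>i j. i < j \<Longrightarrow> j < 4 \<Longrightarrow> f i j \<in> carrier G"
  shows "(\<Oplus>j\<in>{..<4}. \<Oplus>i\<in>{..<j}. f i j) =
    f 0 1 \<oplus> (f 0 2 \<oplus> (f 1 2 \<oplus> (f 0 3 \<oplus> (f 1 3 \<oplus> f 2 3))))"
proof -
  have "{..<4::nat} = {3, 2, 1, 0}" "{..<3::nat} = {2, 1, 0}" "{..<2::nat} = {1, 0}" "{..<Suc 0} = {0}" by auto
  then show ?thesis using assms by (simp add: a_ac)
qed

context lie_algebra
begin

lemma module_L: "module R L" ..

lemma module_ext: "module R (ext_power R L n)"
  by (rule module_ext_power[OF module_L])

lemma is_linear_br_left: "y \<in> carrier L \<Longrightarrow> is_linear R L L (\<lambda>x. br x y)"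
  and is_linear_br_right: "y \<in> carrier L \<Longrightarrow> is_linear R L L (br y)"
  by (auto intro!: is_linearI simp: br_closed br_add_left br_add_right br_smult_left br_smult_right)

text \<open>Polarisation: expand the bracket of \<open>x \<oplus> y\<close> with itself.\<close>

lemma br_swap:
  assumes "x \<in> carrier L" "y \<in> carrier L"
  shows "br y x = \<ominus>\<^bsub>L\<^esub> br x y"
proof -
  note c = assms br_closed
  have "\<zero>\<^bsub>L\<^esub> = br (x \<oplus>\<^bsub>L\<^esub> y) (x \<oplus>\<^bsub>L\<^esub> y)" using c by (simp add: br_self)
  also have "\<dots> = br y x \<oplus>\<^bsub>L\<^esub> br x y"
    using c by (simp add: br_add_left br_add_right br_self[of x] br_self[of y] M.a_comm)
  finally show ?thesis using c by (intro M.minus_equality[symmetric]) auto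
qed

definition ce_term :: "nat \<Rightarrow> nat \<Rightarrow> 'g list \<Rightarrow> ('g list \<Rightarrow> 'r) set set"
  where "ce_term i j xs = wedge R L (br (xs ! i) (xs ! j) # nths xs (- {i, j}))"

text \<open>The varying slot is the left entry of the bracket, its right entry, or one of the
  entries that are kept; in each case a single factor of the wedge depends linearly on it.\<close>

lemma multilin_ce_term:
  assumes ij: "i < j" "j < n"
  shows "multilin R L n (ext_power R L (n - 1)) (ce_term i j)"
proof (rule multilinI)
  note w = multilin_wedge[OF module_L, of "n - 1"]
  show "ce_term i j xs \<in> carrier (ext_power R L (n - 1))" if xs: "xs \<in> tuples L n" for xs
    unfolding ce_term_def
  proof (rule multilinD(1)[OF w])
    show "br (xs ! i) (xs ! j) # nths xs (- {i, j}) \<in> tuples L (n - 1)"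
      using xs ij length_nths_compl_pair[OF ij(1), of xs]
      by (auto simp: tuples_def subset_iff intro!: br_closed dest: in_set_nthsD)
  qed
  fix xs p assume xs: "xs \<in> tuples L n" and p: "p < n"
  have len: "length xs = n" and c: "\<And>k. k < n \<Longrightarrow> xs ! k \<in> carrier L" using xs by (auto simp: tuples_def)
  obtain us vs where uv: "\<And>x. nths (xs[p := x]) (- {i, j}) = us @ (if p \<in> - {i, j} then [x] else []) @ vs"
    and sub: "set us \<subseteq> set xs" "set vs \<subseteq> set xs"
    using nths_list_update[of p xs "- {i, j}"] p len by metis
  have cs: "set us \<subseteq> carrier L" "set vs \<subseteq> carrier L" using sub xs by (auto simp: tuples_def)
  \<comment> \<open>Only lengths matter here, so \<open>undefined\<close> stands for the varying
    entry. The \<open>n - 2\<close> kept entries and the bracket give \<open>n - 1\<close>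
    factors.\<close>
  have l: "length us + length (if p \<in> - {i, j} then [undefined :: 'g] else []) + length vs = n - 2"
    using length_nths_compl_pair[OF ij(1), of "xs[p := undefined]"] ij len unfolding uv by simp
  have n: "2 \<le> n" using ij by simp
  consider "p = i" | "p = j" | "p \<noteq> i" "p \<noteq> j" by blast
  then show "is_linear R L (ext_power R L (n - 1)) (\<lambda>x. ce_term i j (xs[p := x]))"
  proof cases
    case 1
    have "is_linear R L (ext_power R L (n - 1)) (\<lambda>x. wedge R L ([] @ br x (xs ! j) # (us @ vs)))"
      by (rule multilin_is_linear_append[OF w _ _ _ is_linear_br_left module_L])
        (use cs c ij l n 1 in auto)
    then show ?thesis using 1 ij len by (simp add: ce_term_def uv[unfolded 1])
  next
    case 2
    have "is_linear R L (ext_power R L (n - 1)) (\<lambda>x. wedge R L ([] @ br (xs ! i) x # (us @ vs)))"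
      by (rule multilin_is_linear_append[OF w _ _ _ is_linear_br_right module_L])
        (use cs c ij l n 2 in auto)
    then show ?thesis using 2 ij len by (simp add: ce_term_def uv[unfolded 2])
  next
    case 3
    have "is_linear R L (ext_power R L (n - 1)) (\<lambda>x. wedge R L ((br (xs ! i) (xs ! j) # us) @ x # vs))"
      by (rule multilin_is_linear_append[OF w _ _ _ is_linear_ident module_L])
        (use cs c ij l n 3 br_closed in auto)
    then show ?thesis using 3 ij len by (simp add: ce_term_def uv)
  qed
qed

text \<open>The formula prescribed for \<open>ce_boundary\<close>, isolated so that it can be shown
  multilinear and alternating before \<open>the_lin\<close> is resolved.\<close>

definition ce_sum :: "nat \<Rightarrow> 'g list \<Rightarrow> ('g list \<Rightarrow> 'r) set set"
  where "ce_sum n xs = (\<Oplus>\<^bsub>ext_power R L (n - 1)\<^esub>j\<in>{..<n}. \<Oplus>\<^bsub>ext_power R L (n - 1)\<^esub>i\<in>{..<j}.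
         ((\<ominus>\<^bsub>R\<^esub> \<one>\<^bsub>R\<^esub>) [^]\<^bsub>R\<^esub> (i + j)) \<odot>\<^bsub>ext_power R L (n - 1)\<^esub> ce_term i j xs)"

lemma multilin_ce_sum: "multilin R L n (ext_power R L (n - 1)) (ce_sum n)"
proof (rule multilinI)
  interpret E: module R "ext_power R L (n - 1)" by (rule module_ext)
  have t: "ce_term i j xs \<in> carrier (ext_power R L (n - 1))" if "i < j" "j < n" "xs \<in> tuples L n" for i j xs
    by (rule multilinD(1)[OF multilin_ce_term[OF that(1,2)] that(3)])
  show "ce_sum n xs \<in> carrier (ext_power R L (n - 1))" if "xs \<in> tuples L n" for xs
    unfolding ce_sum_def using that t by (intro E.M.finsum_closed Pi_I E.smult_closed) auto
  show "is_linear R L (ext_power R L (n - 1)) (\<lambda>x. ce_sum n (xs[p := x]))"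
    if "xs \<in> tuples L n" "p < n" for xs p
    unfolding ce_sum_def
    by (intro is_linear_finsum_fun is_linear_smult module_ext
        multilin_is_linear[OF multilin_ce_term that]) auto
qed

text \<open>Multilinearity holds for every \<open>n\<close>. Alternation stays a hypothesis, to be
  supplied for \<open>n = 3\<close>, which governs the cycles, and for \<open>n = 4\<close>, which
  governs the boundaries.\<close>

lemma ce_boundary_props:
  assumes alt: "\<And>xs. xs \<in> tuples L n \<Longrightarrow> \<not> distinct xs \<Longrightarrow> ce_sum n xs = \<zero>\<^bsub>ext_power R L (n - 1)\<^esub>"
  shows "is_linear R (ext_power R L n) (ext_power R L (n - 1)) (ce_boundary R L br n)"
    and "\<And>xs. xs \<in> tuples L n \<Longrightarrow> ce_boundary R L br n (wedge R L xs) = ce_sum n xs"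
proof -
  obtain g where g: "is_linear R (ext_power R L n) (ext_power R L (n - 1)) g"
    "\<And>xs. xs \<in> tuples L n \<Longrightarrow> g (wedge R L xs) = ce_sum n xs"
    using ext_power_universal[OF module_L module_ext multilin_ce_sum alt] by blast
  have eq: "ce_boundary R L br n =
      the_lin R (ext_power R L n) (ext_power R L (n - 1)) (tuples L n) (wedge R L) (ce_sum n)"
    unfolding ce_boundary_def ce_sum_def[abs_def] ce_term_def ..
  note p = the_lin_props[OF module_ext module_ext generates_wedge[OF module_L] g]
  show "is_linear R (ext_power R L n) (ext_power R L (n - 1)) (ce_boundary R L br n)"
    and "\<And>xs. xs \<in> tuples L n \<Longrightarrow> ce_boundary R L br n (wedge R L xs) = ce_sum n xs"
    unfolding eq using p by auto
qed

lemma sign_smult: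
  assumes "module R N" "x \<in> carrier N"
  shows "((\<ominus>\<^bsub>R\<^esub> \<one>\<^bsub>R\<^esub>) [^]\<^bsub>R\<^esub> (k::nat)) \<odot>\<^bsub>N\<^esub> x = (if even k then x else \<ominus>\<^bsub>N\<^esub> x)"
proof -
  interpret N: module R N by fact
  show ?thesis
    by (induction k) (auto simp: assms(2) N.smult_assoc1 N.smult_l_minus R.r_minus)
qed

lemma ce_sum_3:
  assumes "x \<in> carrier L" "y \<in> carrier L" "z \<in> carrier L"
  shows "ce_sum 3 [x, y, z] = \<ominus>\<^bsub>ext_power R L 2\<^esub> wedge R L [br x y, z] \<oplus>\<^bsub>ext_power R L 2\<^esub>
    (wedge R L [br x z, y] \<oplus>\<^bsub>ext_power R L 2\<^esub> \<ominus>\<^bsub>ext_power R L 2\<^esub> wedge R L [br y z, x])"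
proof -
  interpret E: module R "ext_power R L 2" by (rule module_ext)
  have w: "wedge R L [u, v] \<in> carrier (ext_power R L 2)" if "u \<in> carrier L" "v \<in> carrier L" for u v
    by (rule multilinD(1)[OF multilin_wedge[OF module_L]]) (use that in \<open>simp add: tuples_2_iff\<close>)
  have t: "ce_term i j [x, y, z] \<in> carrier (ext_power R L 2)" if "i < j" "j < 3" for i j
    using multilinD(1)[OF multilin_ce_term[OF that], of "[x, y, z]"] assms by (simp add: tuples_3_iff)
  have e: "3 - 1 = (2::nat)" by simp
  define f where "f i j = ((\<ominus>\<^bsub>R\<^esub> \<one>\<^bsub>R\<^esub>) [^]\<^bsub>R\<^esub> (i + j)) \<odot>\<^bsub>ext_power R L 2\<^esub> ce_term i j [x, y, z]" for i j :: nat
  have f: "f i j = (if even (i + j) then ce_term i j [x, y, z]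
      else \<ominus>\<^bsub>ext_power R L 2\<^esub> ce_term i j [x, y, z])" if "i < j" "j < 3" for i j
    unfolding f_def by (rule sign_smult[OF module_ext t[OF that]])
  have "ce_sum 3 [x, y, z] = (\<Oplus>\<^bsub>ext_power R L 2\<^esub>j\<in>{..<3}. \<Oplus>\<^bsub>ext_power R L 2\<^esub>i\<in>{..<j}. f i j)"
    unfolding ce_sum_def e f_def ..
  also note E.M.finsum_triangle_3[of f]
  finally show ?thesis using f t by (simp add: ce_term_def nths_Cons)
qed

lemma ce_sum_4:
  assumes "x \<in> carrier L" "y \<in> carrier L" "z \<in> carrier L" "t \<in> carrier L"
  shows "ce_sum 4 [x, y, z, t] =
    \<ominus>\<^bsub>ext_power R L 3\<^esub> wedge R L [br x y, z, t] \<oplus>\<^bsub>ext_power R L 3\<^esub>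
    (wedge R L [br x z, y, t] \<oplus>\<^bsub>ext_power R L 3\<^esub>
    (\<ominus>\<^bsub>ext_power R L 3\<^esub> wedge R L [br y z, x, t] \<oplus>\<^bsub>ext_power R L 3\<^esub>
    (\<ominus>\<^bsub>ext_power R L 3\<^esub> wedge R L [br x t, y, z] \<oplus>\<^bsub>ext_power R L 3\<^esub>
    (wedge R L [br y t, x, z] \<oplus>\<^bsub>ext_power R L 3\<^esub>
     \<ominus>\<^bsub>ext_power R L 3\<^esub> wedge R L [br z t, x, y]))))"
proof -
  interpret E: module R "ext_power R L 3" by (rule module_ext)
  have w: "wedge R L [u, v, v'] \<in> carrier (ext_power R L 3)"
    if "u \<in> carrier L" "v \<in> carrier L" "v' \<in> carrier L" for u v v'
    by (rule multilinD(1)[OF multilin_wedge[OF module_L]]) (use that in \<open>simp add: tuples_3_iff\<close>)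
  have t: "ce_term i j [x, y, z, t] \<in> carrier (ext_power R L 3)" if "i < j" "j < 4" for i j
    using multilinD(1)[OF multilin_ce_term[OF that], of "[x, y, z, t]"] assms by (simp add: tuples_4_iff)
  have e: "4 - 1 = (3::nat)" by simp
  define f where "f i j = ((\<ominus>\<^bsub>R\<^esub> \<one>\<^bsub>R\<^esub>) [^]\<^bsub>R\<^esub> (i + j)) \<odot>\<^bsub>ext_power R L 3\<^esub> ce_term i j [x, y, z, t]" for i j :: nat
  have f: "f i j = (if even (i + j) then ce_term i j [x, y, z, t]
      else \<ominus>\<^bsub>ext_power R L 3\<^esub> ce_term i j [x, y, z, t])" if "i < j" "j < 4" for i j
    unfolding f_def by (rule sign_smult[OF module_ext t[OF that]])
  have "ce_sum 4 [x, y, z, t] = (\<Oplus>\<^bsub>ext_power R L 3\<^esub>j\<in>{..<4}. \<Oplus>\<^bsub>ext_power R L 3\<^esub>i\<in>{..<j}. f i j)"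
    unfolding ce_sum_def e f_def ..
  also note E.M.finsum_triangle_4[of f]
  finally show ?thesis using f t by (simp add: ce_term_def nths_Cons)
qed

end

lemma (in abelian_group) a_inv_zero: "\<ominus> \<zero> = \<zero>"
  by (rule minus_equality) simp_all

text \<open>All four are the first identity with \<open>p\<close>, \<open>q\<close> or both replaced
  by inverses. They cancel two interleaved pairs, in which an element and its inverse are not
  adjacent, as in the boundary of a wedge of four factors with equal outer entries.\<close>

lemma (in abelian_group) four_cancel:
  assumes "p \<in> carrier G" "q \<in> carrier G"
  shows "p \<oplus> (q \<oplus> (\<ominus> p \<oplus> \<ominus> q)) = \<zero>"
    and "\<ominus> p \<oplus> (q \<oplus> (p \<oplus> \<ominus> q)) = \<zero>"
    and "\<ominus> p \<oplus> (\<ominus> q \<oplus> (p \<oplus> q)) = \<zero>"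
    and "p \<oplus> (\<ominus> q \<oplus> (\<ominus> p \<oplus> q)) = \<zero>"
proof -
  have *: "a \<oplus> (b \<oplus> (\<ominus> a \<oplus> \<ominus> b)) = \<zero>" if "a \<in> carrier G" "b \<in> carrier G" for a b
  proof -
    have "a \<oplus> (b \<oplus> (\<ominus> a \<oplus> \<ominus> b)) = (a \<oplus> b) \<oplus> \<ominus> (a \<oplus> b)"
      using that by (simp add: a_assoc minus_add)
    then show ?thesis using that by (simp add: r_neg)
  qed
  from *[of p q] *[of "\<ominus> p" q] *[of "\<ominus> p" "\<ominus> q"] *[of p "\<ominus> q"] assms
  show "p \<oplus> (q \<oplus> (\<ominus> p \<oplus> \<ominus> q)) = \<zero>" "\<ominus> p \<oplus> (q \<oplus> (p \<oplus> \<ominus> q)) = \<zero>"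
    "\<ominus> p \<oplus> (\<ominus> q \<oplus> (p \<oplus> q)) = \<zero>" "p \<oplus> (\<ominus> q \<oplus> (\<ominus> p \<oplus> q)) = \<zero>"
    by simp_all
qed

context lie_algebra
begin

lemma wedge_2_closed:
  "u \<in> carrier L \<Longrightarrow> v \<in> carrier L \<Longrightarrow> wedge R L [u, v] \<in> carrier (ext_power R L 2)"
  by (rule multilinD(1)[OF multilin_wedge[OF module_L]]) (simp add: tuples_2_iff)

lemma wedge_3_closed:
  "u \<in> carrier L \<Longrightarrow> v \<in> carrier L \<Longrightarrow> t \<in> carrier L \<Longrightarrow> wedge R L [u, v, t] \<in> carrier (ext_power R L 3)"
  by (rule multilinD(1)[OF multilin_wedge[OF module_L]]) (simp add: tuples_3_iff)

lemma wedge_2_zero: "u \<in> carrier L \<Longrightarrow> wedge R L [\<zero>\<^bsub>L\<^esub>, u] = \<zero>\<^bsub>ext_power R L 2\<^esub>"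
  and wedge_2_neg: "u \<in> carrier L \<Longrightarrow> v \<in> carrier L \<Longrightarrow>
    wedge R L [\<ominus>\<^bsub>L\<^esub> v, u] = \<ominus>\<^bsub>ext_power R L 2\<^esub> wedge R L [v, u]"
  using is_linear_zero[OF module_L module_ext multilin_is_linear[OF multilin_wedge[OF module_L], of "[u, u]" 2 0]]
    is_linear_neg[OF module_L module_ext multilin_is_linear[OF multilin_wedge[OF module_L], of "[u, u]" 2 0]]
  by (simp_all add: tuples_2_iff)

lemma wedge_3_zero:
    "u \<in> carrier L \<Longrightarrow> t \<in> carrier L \<Longrightarrow> wedge R L [\<zero>\<^bsub>L\<^esub>, u, t] = \<zero>\<^bsub>ext_power R L 3\<^esub>"
  and wedge_3_neg: "u \<in> carrier L \<Longrightarrow> t \<in> carrier L \<Longrightarrow> v \<in> carrier L \<Longrightarrow>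
    wedge R L [\<ominus>\<^bsub>L\<^esub> v, u, t] = \<ominus>\<^bsub>ext_power R L 3\<^esub> wedge R L [v, u, t]"
  using is_linear_zero[OF module_L module_ext multilin_is_linear[OF multilin_wedge[OF module_L], of "[u, u, t]" 3 0]]
    is_linear_neg[OF module_L module_ext multilin_is_linear[OF multilin_wedge[OF module_L], of "[u, u, t]" 3 0]]
  by (simp_all add: tuples_3_iff)

lemma wedge_3_same: "u \<in> carrier L \<Longrightarrow> v \<in> carrier L \<Longrightarrow> wedge R L [u, v, v] = \<zero>\<^bsub>ext_power R L 3\<^esub>"
  by (rule wedge_not_distinct[OF module_L]) (simp_all add: tuples_3_iff)

text \<open>Polarisation in the last two factors, whose repetition gives zero.\<close>

lemma wedge_3_swap:
  assumes "u \<in> carrier L" "v \<in> carrier L" "t \<in> carrier L"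
  shows "wedge R L [u, t, v] = \<ominus>\<^bsub>ext_power R L 3\<^esub> wedge R L [u, v, t]"
proof -
  interpret E: module R "ext_power R L 3" by (rule module_ext)
  note add = multilinD(2)[OF multilin_wedge[OF module_L]]
  have "wedge R L [u, v \<oplus>\<^bsub>L\<^esub> t, v \<oplus>\<^bsub>L\<^esub> t] =
      wedge R L [u, v, v \<oplus>\<^bsub>L\<^esub> t] \<oplus>\<^bsub>ext_power R L 3\<^esub> wedge R L [u, t, v \<oplus>\<^bsub>L\<^esub> t]"
    using add[of "[u, v, v \<oplus>\<^bsub>L\<^esub> t]" 3 1 v t] assms by (simp add: tuples_3_iff)
  also have "wedge R L [u, v, v \<oplus>\<^bsub>L\<^esub> t] = wedge R L [u, v, v] \<oplus>\<^bsub>ext_power R L 3\<^esub> wedge R L [u, v, t]"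
    using add[of "[u, v, v]" 3 2 v t] assms by (simp add: tuples_3_iff)
  also have "wedge R L [u, t, v \<oplus>\<^bsub>L\<^esub> t] = wedge R L [u, t, v] \<oplus>\<^bsub>ext_power R L 3\<^esub> wedge R L [u, t, t]"
    using add[of "[u, t, v]" 3 2 v t] assms by (simp add: tuples_3_iff)
  finally have "wedge R L [u, t, v] \<oplus>\<^bsub>ext_power R L 3\<^esub> wedge R L [u, v, t] = \<zero>\<^bsub>ext_power R L 3\<^esub>"
    using assms by (simp add: wedge_3_same wedge_3_closed E.M.a_comm)
  then show ?thesis using assms by (intro E.M.minus_equality[symmetric]) (auto simp: wedge_3_closed)
qed

text \<open>If two entries agree, the term that brackets them is zero and the other two cancel; for
  \<open>x = z\<close> this takes antisymmetry of the bracket.\<close>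

lemma ce_sum_3_alternating:
  assumes "xs \<in> tuples L 3" "\<not> distinct xs"
  shows "ce_sum 3 xs = \<zero>\<^bsub>ext_power R L 2\<^esub>"
proof -
  interpret E: module R "ext_power R L 2" by (rule module_ext)
  obtain x y z where xs: "xs = [x, y, z]" and c: "x \<in> carrier L" "y \<in> carrier L" "z \<in> carrier L"
    using assms(1) by (auto simp: tuples_def length_Suc_conv eval_nat_numeral)
  note simps = xs ce_sum_3 br_self wedge_2_zero wedge_2_neg wedge_2_closed br_closed
    E.M.l_neg E.M.r_neg E.M.r_neg1 E.M.r_neg2 E.M.a_inv_zero
  consider "x = y" | "x = z" | "y = z" using assms(2) xs by auto
  then show ?thesis
  proof cases
    case 1 with c show ?thesis by (simp add: simps)
  next
    case 2 with c show ?thesis by (simp add: simps br_swap[of z y])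
  next
    case 3 with c show ?thesis by (simp add: simps)
  qed
qed

text \<open>For a pair of equal entries two terms vanish: the one that brackets the pair and the one
  that keeps it. The other four cancel in twos by exchanging the equal entries; depending on the
  positions this uses \<open>br_swap\<close> and \<open>wedge_3_swap\<close>.\<close>

lemma ce_sum_4_alternating:
  assumes "xs \<in> tuples L 4" "\<not> distinct xs"
  shows "ce_sum 4 xs = \<zero>\<^bsub>ext_power R L 3\<^esub>"
proof -
  interpret E: module R "ext_power R L 3" by (rule module_ext)
  obtain x y z t where xs: "xs = [x, y, z, t]"
    and c: "x \<in> carrier L" "y \<in> carrier L" "z \<in> carrier L" "t \<in> carrier L"
    using assms(1) by (auto simp: tuples_def length_Suc_conv eval_nat_numeral)
  note simps = xs ce_sum_4 br_self wedge_3_zero wedge_3_same wedge_3_neg wedge_3_closed br_closed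
    E.M.l_neg E.M.r_neg E.M.r_neg1 E.M.r_neg2 E.M.a_inv_zero E.M.four_cancel
  consider "x = y" | "x = z" | "x = t" | "y = z" | "y = t" | "z = t" using assms(2) xs by auto
  then show ?thesis
  proof cases
    case 1 with c show ?thesis by (simp add: simps)
  next
    case 2 with c show ?thesis by (simp add: simps br_swap[of z y] wedge_3_swap[of _ y z])
  next
    case 3 with c show ?thesis
      by (simp add: simps br_swap[of t y] br_swap[of t z] wedge_3_swap[of _ y t] wedge_3_swap[of _ z t])
  next
    case 4 with c show ?thesis by (simp add: simps)
  next
    case 5 with c show ?thesis by (simp add: simps br_swap[of t z] wedge_3_swap[of _ z t])
  next
    case 6 with c show ?thesis by (simp add: simps)
  qed
qed

lemma is_linear_ce_boundary_3: "is_linear R (ext_power R L 3) (ext_power R L 2) (ce_boundary R L br 3)"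
  and ce_boundary_3: "xs \<in> tuples L 3 \<Longrightarrow> ce_boundary R L br 3 (wedge R L xs) = ce_sum 3 xs"
  using ce_boundary_props[of 3] ce_sum_3_alternating by auto

lemma is_linear_ce_boundary_4: "is_linear R (ext_power R L 4) (ext_power R L 3) (ce_boundary R L br 4)"
  and ce_boundary_4: "xs \<in> tuples L 4 \<Longrightarrow> ce_boundary R L br 4 (wedge R L xs) = ce_sum 4 xs"
  using ce_boundary_props[of 4] ce_sum_4_alternating by auto

section \<open>The Killing module and the Koszul map\<close>

lemma module_sym: "module R (sym_square R L)"
  by (rule module_sym_square[OF module_L])

lemma is_linear_sym_prod_left: "y \<in> carrier L \<Longrightarrow> is_linear R L (sym_square R L) (\<lambda>x. sym_prod R L x y)"
  by (rule is_linearI)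
    (simp_all add: sym_prod_closed[OF module_L] sym_prod_add_left[OF module_L] sym_prod_smult_left[OF module_L])

lemma is_linear_sym_prod_right:
  assumes y: "y \<in> carrier L"
  shows "is_linear R L (sym_square R L) (sym_prod R L y)"
proof -
  have "is_linear R L (sym_square R L) (\<lambda>x. sym_prod R L x y) = is_linear R L (sym_square R L) (sym_prod R L y)"
    using sym_prod_commute[OF module_L y] by (auto simp: is_linear_def Pi_iff)
  then show ?thesis using is_linear_sym_prod_left[OF y] by simp
qed

text \<open>The prescribed value is linear in each of its three arguments, so the universal property
  of the tensor cube supplies the witness that resolves \<open>the_lin\<close>.\<close>

lemma is_linear_kill_rel_map: "is_linear R (tensor_power R L 3) (sym_square R L) (kill_rel_map R L br)" (is ?lin)
  and kill_rel_map: "x \<in> carrier L \<Longrightarrow> y \<in> carrier L \<Longrightarrow> z \<in> carrier L \<Longrightarrow>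
    kill_rel_map R L br (tensor R L [x, y, z]) =
      sym_prod R L (br x y) z \<ominus>\<^bsub>sym_square R L\<^esub> sym_prod R L x (br y z)" (is "_ \<Longrightarrow> _ \<Longrightarrow> _ \<Longrightarrow> ?eq x y z")
proof -
  let ?f = "\<lambda>x y z. sym_prod R L (br x y) z \<ominus>\<^bsub>sym_square R L\<^esub> sym_prod R L x (br y z)"
  interpret S: module R "sym_square R L" by (rule module_sym)
  have "multilin R L 3 (sym_square R L) (\<lambda>xs. ?f (xs ! 0) (xs ! 1) (xs ! 2))"
  proof (rule multilin_3I)
    fix x y z assume "x \<in> carrier L" "y \<in> carrier L" "z \<in> carrier L"
    then show "?f x y z \<in> carrier (sym_square R L)"
      by (intro S.M.minus_closed sym_prod_closed[OF module_L] br_closed)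
  next
    fix y z assume "y \<in> carrier L" "z \<in> carrier L"
    then show "is_linear R L (sym_square R L) (\<lambda>x. ?f x y z)"
      by (intro is_linear_diff module_sym is_linear_sym_prod_left br_closed
          is_linear_compose[OF is_linear_br_left is_linear_sym_prod_left])
  next
    fix x z assume "x \<in> carrier L" "z \<in> carrier L"
    then show "is_linear R L (sym_square R L) (\<lambda>y. ?f x y z)"
      by (intro is_linear_diff module_sym br_closed is_linear_compose[OF is_linear_br_right is_linear_sym_prod_left]
          is_linear_compose[OF is_linear_br_left is_linear_sym_prod_right])
  next
    fix x y assume "x \<in> carrier L" "y \<in> carrier L"
    then show "is_linear R L (sym_square R L) (?f x y)"
      by (intro is_linear_diff module_sym br_closed is_linear_sym_prod_right
          is_linear_compose[OF is_linear_br_right is_linear_sym_prod_right])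
  qed
  then obtain g where g: "is_linear R (tensor_power R L 3) (sym_square R L) g"
    "\<And>xs. xs \<in> tuples L 3 \<Longrightarrow> g (tensor R L xs) = ?f (xs ! 0) (xs ! 1) (xs ! 2)"
    using tensor_power_universal[OF module_L module_sym] by blast
  have gen: "generates R (tensor_power R L 3)
      ((\<lambda>(x, y, z). tensor R L [x, y, z]) ` (carrier L \<times> carrier L \<times> carrier L))"
    unfolding tuples_3_image by (rule generates_tensor[OF module_L])
  have "g (case i of (x, y, z) \<Rightarrow> tensor R L [x, y, z]) = (case i of (x, y, z) \<Rightarrow> ?f x y z)"
    if "i \<in> carrier L \<times> carrier L \<times> carrier L" for i
    using that g(2) by (auto simp: tuples_3_iff)
  note p = the_lin_props[OF module_tensor_power[OF module_L] module_sym gen g(1) this]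
  show ?lin unfolding kill_rel_map_def by (rule p(1))
  show "?eq x y z" if "x \<in> carrier L" "y \<in> carrier L" "z \<in> carrier L"
    unfolding kill_rel_map_def using p(2)[of "(x, y, z)"] that by simp
qed

lemma submodule_kill_rel: "submodule (kill_rel_map R L br ` carrier (tensor_power R L 3)) R (sym_square R L)"
  by (rule submodule_image[OF module_tensor_power[OF module_L] module_sym is_linear_kill_rel_map])

lemma module_killing_module: "module R (killing_module R L br)"
  unfolding killing_module_def by (rule module_quot_mod[OF module_sym submodule_kill_rel])

text \<open>The universal symmetric invariant bilinear form, denoted by a dot in the
  overview.\<close>

definition kill_form :: "'g \<Rightarrow> 'g \<Rightarrow> ('g list \<Rightarrow> 'r) set set set"
  where "kill_form x y = kill_class R L br (sym_prod R L x y)"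

lemma is_linear_kill_class: "is_linear R (sym_square R L) (killing_module R L br) (kill_class R L br)"
  using is_linear_coset[OF module_sym submodule_kill_rel]
  by (simp add: killing_module_def kill_class_def[abs_def])

lemma is_linear_kill_form_left:
    "y \<in> carrier L \<Longrightarrow> is_linear R L (killing_module R L br) (\<lambda>x. kill_form x y)"
  and is_linear_kill_form_right: "y \<in> carrier L \<Longrightarrow> is_linear R L (killing_module R L br) (kill_form y)"
  unfolding kill_form_def[abs_def]
  by (rule is_linear_compose[OF is_linear_sym_prod_left is_linear_kill_class]
      is_linear_compose[OF is_linear_sym_prod_right is_linear_kill_class]; assumption)+

lemma kill_form_closed:
  "x \<in> carrier L \<Longrightarrow> y \<in> carrier L \<Longrightarrow> kill_form x y \<in> carrier (killing_module R L br)"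
  by (rule is_linearD(1)[OF is_linear_kill_form_right])

lemma kill_form_commute: "x \<in> carrier L \<Longrightarrow> y \<in> carrier L \<Longrightarrow> kill_form x y = kill_form y x"
  by (simp add: kill_form_def sym_prod_commute[OF module_L])

lemma kill_form_invariant:
  assumes "x \<in> carrier L" "y \<in> carrier L" "z \<in> carrier L"
  shows "kill_form (br x y) z = kill_form x (br y z)"
proof -
  have "sym_prod R L (br x y) z \<ominus>\<^bsub>sym_square R L\<^esub> sym_prod R L x (br y z)
      \<in> kill_rel_map R L br ` carrier (tensor_power R L 3)"
    using kill_rel_map[OF assms, symmetric] tensor_mem[OF module_L, of "[x, y, z]" 3] assms
    by (auto simp: tuples_3_iff)
  then show ?thesis
    using coset_eq_iff[OF module_sym submodule_kill_rel] assms
    by (simp add: kill_form_def kill_class_def sym_prod_closed[OF module_L] br_closed)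
qed

lemma kill_form_zero_right: "x \<in> carrier L \<Longrightarrow> kill_form x \<zero>\<^bsub>L\<^esub> = \<zero>\<^bsub>killing_module R L br\<^esub>"
  by (rule is_linear_zero[OF module_L module_killing_module is_linear_kill_form_right])

lemma kill_form_neg_right: "x \<in> carrier L \<Longrightarrow> y \<in> carrier L \<Longrightarrow>
    kill_form x (\<ominus>\<^bsub>L\<^esub> y) = \<ominus>\<^bsub>killing_module R L br\<^esub> kill_form x y"
  by (rule is_linear_neg[OF module_L module_killing_module is_linear_kill_form_right])

text \<open>This is the well-definedness of \<eta> on the exterior cube. Trilinearity is inherited
  from the bracket and the form; alternation rests on invariance.\<close>

lemma is_linear_koszul_map: "is_linear R (ext_power R L 3) (killing_module R L br) (koszul_map R L br)" (is ?lin)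
  and koszul_map: "x \<in> carrier L \<Longrightarrow> y \<in> carrier L \<Longrightarrow> z \<in> carrier L \<Longrightarrow>
    koszul_map R L br (wedge R L [x, y, z]) = kill_form x (br y z)" (is "_ \<Longrightarrow> _ \<Longrightarrow> _ \<Longrightarrow> ?eq x y z")
proof -
  let ?f = "\<lambda>x y z. kill_form x (br y z)" and ?K = "killing_module R L br"
  interpret K: module R ?K by (rule module_killing_module)
  have mult: "multilin R L 3 ?K (\<lambda>xs. ?f (xs ! 0) (xs ! 1) (xs ! 2))"
    by (rule multilin_3I)
      (auto intro: kill_form_closed br_closed is_linear_kill_form_left
        is_linear_compose[OF is_linear_br_left is_linear_kill_form_right]
        is_linear_compose[OF is_linear_br_right is_linear_kill_form_right])
  have alt: "?f (xs ! 0) (xs ! 1) (xs ! 2) = \<zero>\<^bsub>?K\<^esub>" if xs3: "xs \<in> tuples L 3" and nd: "\<not> distinct xs" for xs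
  proof -
    obtain x y z where xs: "xs = [x, y, z]" and c: "x \<in> carrier L" "y \<in> carrier L" "z \<in> carrier L"
      using xs3 by (auto simp: tuples_def length_Suc_conv eval_nat_numeral)
    \<comment> \<open>By invariance, pairing \<open>u\<close> with \<open>br u v\<close> is pairing
      \<open>br u u\<close>, which is zero, with \<open>v\<close>.\<close>
    have *: "kill_form u (br u v) = \<zero>\<^bsub>?K\<^esub>" if "u \<in> carrier L" "v \<in> carrier L" for u v
      using that kill_form_invariant[of u u v, symmetric]
      by (simp add: br_self kill_form_commute[of "\<zero>\<^bsub>L\<^esub>" v] kill_form_zero_right)
    consider "x = y" | "x = z" | "y = z" using nd xs by auto
    then show ?thesis
    proof cases
      case 1 with c xs * show ?thesis by simp
    next
      case 2 with c xs * show ?thesis by (simp add: br_swap[of z y] kill_form_neg_right br_closed)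
    next
      case 3 with c xs show ?thesis by (simp add: br_self kill_form_zero_right)
    qed
  qed
  obtain g where g: "is_linear R (ext_power R L 3) ?K g"
    "\<And>xs. xs \<in> tuples L 3 \<Longrightarrow> g (wedge R L xs) = ?f (xs ! 0) (xs ! 1) (xs ! 2)"
    using ext_power_universal[OF module_L module_killing_module mult alt] by blast
  have gen: "generates R (ext_power R L 3)
      ((\<lambda>(x, y, z). wedge R L [x, y, z]) ` (carrier L \<times> carrier L \<times> carrier L))"
    unfolding tuples_3_image by (rule generates_wedge[OF module_L])
  have "g (case i of (x, y, z) \<Rightarrow> wedge R L [x, y, z]) = (case i of (x, y, z) \<Rightarrow> kill_class R L br (sym_prod R L x (br y z)))"
    if "i \<in> carrier L \<times> carrier L \<times> carrier L" for i
    using that g(2) by (auto simp: tuples_3_iff kill_form_def)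
  note p = the_lin_props[OF module_ext module_killing_module gen g(1) this]
  show ?lin unfolding koszul_map_def by (rule p(1))
  show "?eq x y z" if "x \<in> carrier L" "y \<in> carrier L" "z \<in> carrier L"
    unfolding koszul_map_def kill_form_def using p(2)[of "(x, y, z)"] that by simp
qed

end

section \<open>Rational characters of torsion-free abelian groups\<close>

text \<open>Partial additive maps \<open>A \<rightarrow> \<rat>\<close>, encoded by their graphs so that Zorn's lemma applies to inclusion.\<close>

definition rat_graph :: "('a, 'k) ring_scheme \<Rightarrow> ('a \<times> rat) set \<Rightarrow> bool"
  where "rat_graph A S \<longleftrightarrow> S \<subseteq> carrier A \<times> UNIV \<and> (\<zero>\<^bsub>A\<^esub>, 0) \<in> S \<and>
    (\<forall>a p b q. (a, p) \<in> S \<longrightarrow> (b, q) \<in> S \<longrightarrow> (a \<ominus>\<^bsub>A\<^esub> b, p - q) \<in> S) \<and>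
    (\<forall>q. (\<zero>\<^bsub>A\<^esub>, q) \<in> S \<longrightarrow> q = 0)"

context abelian_group
begin

lemma rat_graphD:
  assumes "rat_graph G S"
  shows "(a, p) \<in> S \<Longrightarrow> a \<in> carrier G" "(\<zero>, 0) \<in> S"
    and "(a, p) \<in> S \<Longrightarrow> (b, q) \<in> S \<Longrightarrow> (a \<ominus> b, p - q) \<in> S"
    and "(\<zero>, q) \<in> S \<Longrightarrow> q = 0"
  using assms unfolding rat_graph_def by blast+

lemma rat_graph_neg:
  assumes "rat_graph G S" "(a, p) \<in> S"
  shows "(\<ominus> a, - p) \<in> S"
  using rat_graphD(3)[OF assms(1) rat_graphD(2)[OF assms(1)] assms(2)] rat_graphD(1)[OF assms]
  by (simp add: minus_eq)

lemma rat_graph_add: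
  assumes "rat_graph G S" "(a, p) \<in> S" "(b, q) \<in> S"
  shows "(a \<oplus> b, p + q) \<in> S"
  using rat_graphD(3)[OF assms(1,2) rat_graph_neg[OF assms(1,3)]] rat_graphD(1)[OF assms(1)] assms(2,3)
  by (simp add: minus_eq)

text \<open>Single-valuedness is recorded only at zero; closure under differences spreads it to
  every argument.\<close>

lemma rat_graph_unique:
  assumes "rat_graph G S" "(a, p) \<in> S" "(a, q) \<in> S"
  shows "p = q"
proof -
  have "(a \<ominus> a, p - q) \<in> S" using rat_graphD(3)[OF assms] .
  moreover have "a \<ominus> a = \<zero>" using rat_graphD(1)[OF assms(1,2)] by (simp add: minus_eq r_neg)
  ultimately show ?thesis using rat_graphD(4)[OF assms(1)] by fastforce
qed

lemma int_add_pow_0: "[(0::int)] \<cdot> a = \<zero>"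
  by (simp add: add_pow_def)

lemma rat_graph_mult:
  assumes "rat_graph G S" "(a, p) \<in> S"
  shows "([(k::int)] \<cdot> a, of_int k * p) \<in> S"
proof (induction k rule: int_induct[where k = 0])
  case base show ?case using rat_graphD(2)[OF assms(1)] by (simp add: int_add_pow_0)
next
  case (step1 k)
  then show ?case using rat_graph_add[OF assms(1) step1(2) assms(2)] rat_graphD(1)[OF assms]
    by (simp add: add.int_pow_mult a_comm algebra_simps)
next
  case (step2 k)
  then show ?case using rat_graphD(3)[OF assms(1) step2(2) assms(2)] rat_graphD(1)[OF assms]
    by (simp add: add.int_pow_diff minus_eq algebra_simps)
qed

text \<open>The element \<open>a\<close> is adjoined with value \<open>r\<close>. The hypothesis
  says that every multiple of \<open>a\<close> already in the domain has the value that
  \<open>r\<close> predicts; this is what keeps the value at zero unique.\<close>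

lemma rat_graph_extend:
  assumes S: "rat_graph G S" and a: "a \<in> carrier G"
    and r: "\<And>k q. ([(k::int)] \<cdot> a, q) \<in> S \<Longrightarrow> q = of_int k * r"
  shows "rat_graph G {(m \<oplus> [k] \<cdot> a, p + of_int k * r) | m p (k::int). (m, p) \<in> S}"
  unfolding rat_graph_def
proof (intro conjI allI impI)
  note SD = rat_graphD[OF S]
  let ?T = "{(m \<oplus> [k] \<cdot> a, p + of_int k * r) | m p (k::int). (m, p) \<in> S}"
  show "?T \<subseteq> carrier G \<times> UNIV" using SD(1) a by auto
  show "(\<zero>, 0) \<in> ?T" using SD(2) a by (auto intro!: exI[of _ "\<zero>"] exI[of _ "0::rat"] exI[of _ "0::int"] simp: int_add_pow_0)
  fix b p c q assume "(b, p) \<in> ?T" "(c, q) \<in> ?T"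
  then obtain m u k n v l where *: "(m, u) \<in> S" "(n, v) \<in> S"
    and eq: "b = m \<oplus> [(k::int)] \<cdot> a" "p = u + of_int k * r" "c = n \<oplus> [(l::int)] \<cdot> a" "q = v + of_int l * r"
    by blast
  have c: "m \<in> carrier G" "n \<in> carrier G" using SD(1) * by auto
  have "b \<ominus> c = (m \<ominus> n) \<oplus> [(k - l)] \<cdot> a" unfolding eq
    using c a by (simp add: minus_eq minus_add add.int_pow_diff a_ac)
  moreover have "p - q = (u - v) + of_int (k - l) * r" unfolding eq by (simp add: algebra_simps)
  ultimately show "(b \<ominus> c, p - q) \<in> ?T" using SD(3)[OF *] by blast
next
  fix q assume "(\<zero>, q) \<in> {(m \<oplus> [k] \<cdot> a, p + of_int k * r) | m p (k::int). (m, p) \<in> S}"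
  then obtain m p k where *: "(m, p) \<in> S" "\<zero> = m \<oplus> [(k::int)] \<cdot> a" "q = p + of_int k * r" by blast
  have m: "m \<in> carrier G" using rat_graphD(1)[OF S *(1)] .
  \<comment> \<open>A zero sum puts \<open>[k] \<cdot> a\<close> into the old domain as the negative
    of \<open>m\<close>, so its value \<open>- p\<close> is the predicted one.\<close>
  have "[k] \<cdot> a = \<ominus> m" using *(2) m a by (metis add.inv_equality add.int_pow_closed a_comm)
  then have "- p = of_int k * r" using r rat_graph_neg[OF S *(1)] by simp
  then show "q = 0" using *(3) by simp
qed

text \<open>Torsion-freeness makes the value \<open>k\<close> at the k-th multiple of
  \<open>\<alpha>\<close> well defined on the cyclic subgroup. A maximal graph containing
  \<open>(\<alpha>, 1)\<close> is total, because a rational can be divided by any nonzero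
  integer.\<close>

lemma torsion_free_rat_character:
  assumes tf: "torsion_free_group G" and \<alpha>: "\<alpha> \<in> carrier G" "\<alpha> \<noteq> \<zero>"
  obtains f :: "'a \<Rightarrow> rat" where "f \<alpha> = 1"
    "\<And>a b. a \<in> carrier G \<Longrightarrow> b \<in> carrier G \<Longrightarrow> f (a \<oplus> b) = f a + f b"
proof -
  define \<P> where "\<P> = {S. rat_graph G S \<and> (\<alpha>, 1) \<in> S}"
  have z: "rat_graph G {(\<zero>, 0)}" by (auto simp: rat_graph_def minus_eq r_neg)
  \<comment> \<open>\<open>torsion_free_group\<close> speaks of positive natural multiples, so the
    integer \<open>k\<close> is replaced by its absolute value.\<close>
  have inj: "k = 0" if "[(k::int)] \<cdot> \<alpha> = \<zero>" for k
  proof (rule ccontr)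
    assume "k \<noteq> 0"
    then have n: "0 < nat \<bar>k\<bar>" by simp
    have "[nat \<bar>k\<bar>] \<cdot> \<alpha> = \<zero>"
    proof (cases "k \<ge> 0")
      case True then show ?thesis using that by (simp add: add_pow_int_ge)
    next
      case False
      then have "\<ominus> ([nat (- k)] \<cdot> \<alpha>) = \<zero>" using that by (simp add: add_pow_int_lt)
      then have "[nat (- k)] \<cdot> \<alpha> = \<ominus> \<zero>"
        using \<alpha>(1) by (metis add.nat_pow_closed minus_minus)
      then show ?thesis using False by (simp add: a_inv_zero)
    qed
    then show False using tf \<alpha> n by (auto simp: torsion_free_group_def)
  qed
  \<comment> \<open>Extending the trivial graph by \<open>\<alpha>\<close> with value 1 gives the
    graph on the cyclic subgroup, so the family for Zorn's lemma is nonempty.\<close>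
  have "rat_graph G {(m \<oplus> [k] \<cdot> \<alpha>, p + of_int k * 1) | m p (k::int). (m, p) \<in> {(\<zero>, 0)}}"
    by (rule rat_graph_extend[OF z \<alpha>(1)]) (use inj in auto)
  moreover have "(\<alpha>, 1) \<in> {(m \<oplus> [k] \<cdot> \<alpha>, p + of_int k * 1) | m p (k::int). (m, p) \<in> {(\<zero>, 0)}}"
    using \<alpha>(1) by (auto intro!: exI[of _ "1::int"] simp: add.int_pow_1)
  ultimately have ne: "\<P> \<noteq> {}" unfolding \<P>_def by blast
  obtain S where S: "rat_graph G S" "(\<alpha>, 1) \<in> S"
    and max: "\<And>T. rat_graph G T \<Longrightarrow> (\<alpha>, 1) \<in> T \<Longrightarrow> S \<subseteq> T \<Longrightarrow> T = S"
  proof -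
    have "\<exists>S\<in>\<P>. \<forall>T\<in>\<P>. S \<subseteq> T \<longrightarrow> T = S"
    proof (rule subset_Zorn_nonempty[OF ne])
      fix C assume C: "C \<noteq> {}" "subset.chain \<P> C"
      then have g: "\<And>S. S \<in> C \<Longrightarrow> rat_graph G S \<and> (\<alpha>, 1) \<in> S"
        by (auto simp: subset.chain_def \<P>_def)
      have lin: "\<And>S T. S \<in> C \<Longrightarrow> T \<in> C \<Longrightarrow> S \<subseteq> T \<or> T \<subseteq> S"
        using C(2) by (auto simp: subset_chain_def)
      have "rat_graph G (\<Union>C)"
        unfolding rat_graph_def
      proof (intro conjI allI impI)
        show "\<Union>C \<subseteq> carrier G \<times> UNIV" using g unfolding rat_graph_def by blast
        show "(\<zero>, 0) \<in> \<Union>C" using g C(1) unfolding rat_graph_def by blast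
        show "q = 0" if "(\<zero>, q) \<in> \<Union>C" for q using that g unfolding rat_graph_def by blast
        fix a p b q assume "(a, p) \<in> \<Union>C" "(b, q) \<in> \<Union>C"
        then obtain S T where ST: "S \<in> C" "T \<in> C" "(a, p) \<in> S" "(b, q) \<in> T" by blast
        \<comment> \<open>Of two members of a chain one contains the other, so both pairs lie in a
          common member.\<close>
        then obtain U where "U \<in> C" "(a, p) \<in> U" "(b, q) \<in> U" using lin by blast
        then show "(a \<ominus> b, p - q) \<in> \<Union>C" using g rat_graphD(3) by blast
      qed
      then show "\<Union>C \<in> \<P>" using g C(1) unfolding \<P>_def by blast
    qed
    then show ?thesis using that unfolding \<P>_def by blast
  qed
  have ex: "\<exists>q. (a, q) \<in> S" if a: "a \<in> carrier G" for a
  proof -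
    \<comment> \<open>If a nonzero multiple of \<open>a\<close> already has a value, division by
      \<open>k\<close> forces the value at \<open>a\<close>. If only the zero multiple lies in the
      domain, any rational will do and 0 is taken.\<close>
    obtain r where r: "\<And>k q. ([(k::int)] \<cdot> a, q) \<in> S \<Longrightarrow> q = of_int k * r"
    proof (cases "\<exists>k q. k \<noteq> 0 \<and> ([(k::int)] \<cdot> a, q) \<in> S")
      case True
      then obtain k q where k: "k \<noteq> 0" "([(k::int)] \<cdot> a, q) \<in> S" by blast
      have "q' = of_int l * (q / of_int k)" if l: "([(l::int)] \<cdot> a, q') \<in> S" for l q'
      proof -
        \<comment> \<open>The multiple by \<open>l * k\<close> is reached from both known multiples;
          uniqueness of its value makes the quotient independent of the multiple used.\<close>
        have "([(l * k)] \<cdot> a, of_int l * q) \<in> S" "([(l * k)] \<cdot> a, of_int k * q') \<in> S"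
          using rat_graph_mult[OF S(1) k(2), of l] rat_graph_mult[OF S(1) l, of k] a
          by (simp_all add: add.int_pow_pow mult.commute)
        then have "of_int l * q = of_int k * q'" by (rule rat_graph_unique[OF S(1)])
        then show ?thesis using k(1) by (simp add: field_simps)
      qed
      then show ?thesis using that by blast
    next
      case False
      then have "q = of_int k * 0" if "([(k::int)] \<cdot> a, q) \<in> S" for k q
        using that rat_graphD(4)[OF S(1)] by (cases "k = 0") (auto simp: int_add_pow_0)
      then show ?thesis using that by blast
    qed
    let ?T = "{(m \<oplus> [k] \<cdot> a, p + of_int k * r) | m p (k::int). (m, p) \<in> S}"
    have T: "rat_graph G ?T" by (rule rat_graph_extend[OF S(1) a r])
    have sub: "S \<subseteq> ?T"
    proof
      fix x assume x: "x \<in> S"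
      obtain m p where mp: "x = (m, p)" by (cases x)
      then have "x = (m \<oplus> [(0::int)] \<cdot> a, p + of_int 0 * r)"
        using x rat_graphD(1)[OF S(1)] by (simp add: int_add_pow_0)
      moreover have "(m, p) \<in> S" using x mp by simp
      ultimately show "x \<in> ?T" unfolding mem_Collect_eq by (intro exI conjI)
    qed
    then have "?T = S" by (intro max[OF T]) (rule subsetD[OF sub S(2)])
    \<comment> \<open>The choice \<open>m = \<zero>\<close>, \<open>k = 1\<close> exhibits the pair
      \<open>(a, r)\<close>, up to neutral summands. As the extension equals \<open>S\<close>, the
      pair was there already.\<close>
    moreover have "(\<zero> \<oplus> [(1::int)] \<cdot> a, 0 + of_int 1 * r) \<in> ?T"
      unfolding mem_Collect_eq using rat_graphD(2)[OF S(1)] by (intro exI conjI) (rule refl)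
    ultimately have "(\<zero> \<oplus> [(1::int)] \<cdot> a, 0 + of_int 1 * r) \<in> S" by (simp only:)
    then show ?thesis using a by auto
  qed
  define f where "f a = (SOME q. (a, q) \<in> S)" for a
  have f: "(a, f a) \<in> S" if "a \<in> carrier G" for a
    unfolding f_def using ex[OF that] by (rule someI_ex)
  note u = rat_graph_unique[OF S(1)]
  show ?thesis
  proof (rule that)
    show "f \<alpha> = 1" using u[OF f[OF \<alpha>(1)] S(2)] .
    show "f (a \<oplus> b) = f a + f b" if "a \<in> carrier G" "b \<in> carrier G" for a b
      using u[OF f rat_graph_add[OF S(1) f f]] that by simp
  qed
qed

end

section \<open>Scaling the homogeneous components\<close>

text \<open>Scaling componentwise is well defined by uniqueness of decompositions. The decomposition
  in \<open>internal_direct_sum\<close> is indexed by its exact support, whereas adding two of them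
  needs a common index set; most of the proof bridges this.\<close>

lemma grading_scaling:
  assumes M: "module R M" and G: "internal_direct_sum R M I G" and c: "\<And>i. i \<in> I \<Longrightarrow> c i \<in> carrier R"
  obtains D where "is_linear R M M D" "\<And>i x. i \<in> I \<Longrightarrow> x \<in> G i \<Longrightarrow> D x = c i \<odot>\<^bsub>M\<^esub> x"
proof -
  interpret M: module R M by fact
  have sub: "submodule (G i) R M" if "i \<in> I" for i using G that by (simp add: internal_direct_sum_def)
  note sm = submodule_memD[OF M sub]
  define P where "P x f \<longleftrightarrow> f \<in> Pi\<^sub>E I G \<and> finite {i\<in>I. f i \<noteq> \<zero>\<^bsub>M\<^esub>} \<and>
     x = (\<Oplus>\<^bsub>M\<^esub>i\<in>{i\<in>I. f i \<noteq> \<zero>\<^bsub>M\<^esub>}. f i)" for x f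
  have ex1: "\<exists>!f. P x f" if "x \<in> carrier M" for x
    using G that by (simp add: internal_direct_sum_def P_def)
  define D where "D x = (\<Oplus>\<^bsub>M\<^esub>i\<in>{i\<in>I. (THE f. P x f) i \<noteq> \<zero>\<^bsub>M\<^esub>}. c i \<odot>\<^bsub>M\<^esub> (THE f. P x f) i)" for x
  have D: "D x = (\<Oplus>\<^bsub>M\<^esub>i\<in>E. c i \<odot>\<^bsub>M\<^esub> f i)"
    if E: "finite E" "E \<subseteq> I" and f: "\<And>i. i \<in> E \<Longrightarrow> f i \<in> G i" and x: "x = (\<Oplus>\<^bsub>M\<^esub>i\<in>E. f i)" for x E f
  proof -
    \<comment> \<open>Components are zero outside \<open>E\<close>, and \<open>undefined\<close>
      outside \<open>I\<close> as membership in \<open>Pi\<^sub>E I G\<close> requires.\<close>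
    let ?f = "\<lambda>i\<in>I. if i \<in> E then f i else \<zero>\<^bsub>M\<^esub>"
    have fM: "f i \<in> carrier M" if "i \<in> E" for i using f[OF that] sm(1) that E(2) by blast
    have xM: "x \<in> carrier M" unfolding x using fM by (intro M.M.finsum_closed) auto
    have s: "{i \<in> I. ?f i \<noteq> \<zero>\<^bsub>M\<^esub>} \<subseteq> E" by auto
    have "(\<Oplus>\<^bsub>M\<^esub>i\<in>{i\<in>I. ?f i \<noteq> \<zero>\<^bsub>M\<^esub>}. ?f i) = x"
      unfolding x by (rule M.add.finprod_mono_neutral_cong_left) (use E fM s in auto)
    moreover have "?f \<in> Pi\<^sub>E I G" using f sm(2) by auto
    ultimately have "P x ?f"
      using finite_subset[OF s E(1)] unfolding P_def by (intro conjI) (assumption | erule sym)+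
    then have the: "(THE f. P x f) = ?f" using ex1[OF xM] by (rule the1_equality[rotated])
    show ?thesis unfolding D_def the
      by (rule M.add.finprod_mono_neutral_cong_left) (use E fM s c in \<open>auto simp: subset_iff\<close>)
  qed
  have dec: "\<exists>E f. finite E \<and> E \<subseteq> I \<and> (\<forall>i\<in>I. f i \<in> G i) \<and> (\<forall>i\<in>I - E. f i = \<zero>\<^bsub>M\<^esub>) \<and> x = (\<Oplus>\<^bsub>M\<^esub>i\<in>E. f i)"
    if x: "x \<in> carrier M" for x
  proof -
    obtain f where "P x f" using ex1[OF x] by blast
    then show ?thesis by (intro exI[of _ "{i\<in>I. f i \<noteq> \<zero>\<^bsub>M\<^esub>}"] exI[of _ f]) (auto simp: P_def)
  qed
  have "is_linear R M M D"
  proof (rule is_linearI)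
    fix x assume x: "x \<in> carrier M"
    obtain E f where E: "finite E" "E \<subseteq> I" and f: "\<And>i. i \<in> I \<Longrightarrow> f i \<in> G i"
      "\<And>i. i \<in> I - E \<Longrightarrow> f i = \<zero>\<^bsub>M\<^esub>" and xE: "x = (\<Oplus>\<^bsub>M\<^esub>i\<in>E. f i)"
      using dec[OF x] by blast
    have fM: "f i \<in> carrier M" if "i \<in> I" for i using f(1) sm(1) that by blast
    have Dx: "D x = (\<Oplus>\<^bsub>M\<^esub>i\<in>E. c i \<odot>\<^bsub>M\<^esub> f i)" by (rule D[OF E _ xE]) (use f E in auto)
    show "D x \<in> carrier M" unfolding Dx using c fM E by (intro M.M.finsum_closed) auto
    show "D (a \<odot>\<^bsub>M\<^esub> x) = a \<odot>\<^bsub>M\<^esub> D x" if a: "a \<in> carrier R" for a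
    proof -
      have "a \<odot>\<^bsub>M\<^esub> x = (\<Oplus>\<^bsub>M\<^esub>i\<in>E. a \<odot>\<^bsub>M\<^esub> f i)"
        unfolding xE by (rule M.finsum_smult_ldistr) (use a E fM in auto)
      from D[OF E _ this] have "D (a \<odot>\<^bsub>M\<^esub> x) = (\<Oplus>\<^bsub>M\<^esub>i\<in>E. c i \<odot>\<^bsub>M\<^esub> (a \<odot>\<^bsub>M\<^esub> f i))"
        using a f(1) E sm(5) by blast
      also have "\<dots> = (\<Oplus>\<^bsub>M\<^esub>i\<in>E. a \<odot>\<^bsub>M\<^esub> (c i \<odot>\<^bsub>M\<^esub> f i))"
        using a c fM E by (intro M.M.finsum_cong') (auto simp flip: M.smult_assoc1 simp: M.R.m_comm subset_iff)
      also have "\<dots> = a \<odot>\<^bsub>M\<^esub> D x"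
        unfolding Dx by (rule M.finsum_smult_ldistr[symmetric]) (use a c E fM in auto)
      finally show ?thesis .
    qed
    fix y assume y: "y \<in> carrier M"
    obtain F g where F: "finite F" "F \<subseteq> I" and g: "\<And>i. i \<in> I \<Longrightarrow> g i \<in> G i"
      "\<And>i. i \<in> I - F \<Longrightarrow> g i = \<zero>\<^bsub>M\<^esub>" and yF: "y = (\<Oplus>\<^bsub>M\<^esub>i\<in>F. g i)"
      using dec[OF y] by blast
    have gM: "g i \<in> carrier M" if "i \<in> I" for i using g(1) sm(1) that by blast
    let ?U = "E \<union> F"
    have U: "finite ?U" "?U \<subseteq> I" using E F by auto
    have xU: "x = (\<Oplus>\<^bsub>M\<^esub>i\<in>?U. f i)"
      unfolding xE by (rule M.add.finprod_mono_neutral_cong_left) (use U f(2) fM in auto)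
    have yU: "y = (\<Oplus>\<^bsub>M\<^esub>i\<in>?U. g i)"
      unfolding yF by (rule M.add.finprod_mono_neutral_cong_left) (use U g(2) gM in auto)
    have "x \<oplus>\<^bsub>M\<^esub> y = (\<Oplus>\<^bsub>M\<^esub>i\<in>?U. f i \<oplus>\<^bsub>M\<^esub> g i)"
      unfolding xU yU by (rule M.M.finsum_addf[symmetric]) (use U fM gM in auto)
    from D[OF U _ this] have "D (x \<oplus>\<^bsub>M\<^esub> y) = (\<Oplus>\<^bsub>M\<^esub>i\<in>?U. c i \<odot>\<^bsub>M\<^esub> (f i \<oplus>\<^bsub>M\<^esub> g i))"
      using f(1) g(1) U sm(3) by blast
    also have "\<dots> = (\<Oplus>\<^bsub>M\<^esub>i\<in>?U. c i \<odot>\<^bsub>M\<^esub> f i \<oplus>\<^bsub>M\<^esub> c i \<odot>\<^bsub>M\<^esub> g i)"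
      using c fM gM U by (intro M.M.finsum_cong') (auto simp: M.smult_r_distr subset_iff)
    also have "\<dots> = (\<Oplus>\<^bsub>M\<^esub>i\<in>?U. c i \<odot>\<^bsub>M\<^esub> f i) \<oplus>\<^bsub>M\<^esub> (\<Oplus>\<^bsub>M\<^esub>i\<in>?U. c i \<odot>\<^bsub>M\<^esub> g i)"
      by (rule M.M.finsum_addf) (use U c fM gM in auto)
    also have "\<dots> = D x \<oplus>\<^bsub>M\<^esub> D y"
      using D[OF U f(1)[OF subsetD[OF U(2)]] xU] D[OF U g(1)[OF subsetD[OF U(2)]] yU] by simp
    finally show "D (x \<oplus>\<^bsub>M\<^esub> y) = D x \<oplus>\<^bsub>M\<^esub> D y" .
  qed
  moreover have "D x = c i \<odot>\<^bsub>M\<^esub> x" if i: "i \<in> I" and x: "x \<in> G i" for i x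
  proof -
    have xM: "x \<in> carrier M" using sm(1)[OF i x] .
    have "x = (\<Oplus>\<^bsub>M\<^esub>j\<in>{i}. x)" using xM by simp
    then have "D x = (\<Oplus>\<^bsub>M\<^esub>j\<in>{i}. c j \<odot>\<^bsub>M\<^esub> x)" by (rule D[rotated 3]) (use i x in auto)
    then show ?thesis using xM c[OF i] by simp
  qed
  ultimately show ?thesis using that by blast
qed

section \<open>The reduced Koszul map\<close>

text \<open>With \<open>a\<close>, \<open>b\<close>, \<open>c\<close> the scalars attached to three
  homogeneous elements, the summands are the coefficients produced by the three terms of the
  boundary.\<close>

lemma (in abelian_group) sum_of_differences:
  assumes "a \<in> carrier G" "b \<in> carrier G" "c \<in> carrier G"
  shows "(a \<oplus> b \<ominus> c) \<oplus> ((a \<oplus> c \<ominus> b) \<oplus> (b \<oplus> c \<ominus> a)) = a \<oplus> (b \<oplus> c)"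
proof -
  have "(a \<oplus> b \<ominus> c) \<oplus> ((a \<oplus> c \<ominus> b) \<oplus> (b \<oplus> c \<ominus> a)) =
      (a \<oplus> \<ominus> a) \<oplus> ((b \<oplus> \<ominus> b) \<oplus> ((c \<oplus> \<ominus> c) \<oplus> (a \<oplus> (b \<oplus> c))))"
    using assms by (simp add: minus_eq a_ac)
  then show ?thesis using assms by (simp add: r_neg)
qed

context lie_algebra
begin

text \<open>Each of the six terms is a pairing of two brackets. The four elements split into two
  pairs in three ways, and by symmetry of the form each splitting occurs twice with the same sign.
  The total is minus twice \<open>P - Q + S\<close>, which by invariance pairs \<open>x\<close> with
  the Jacobi sum of \<open>y\<close>, \<open>z\<close>, \<open>t\<close>.\<close>

lemma koszul_map_ce_boundary_4:
  assumes "w \<in> carrier (ext_power R L 4)"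
  shows "koszul_map R L br (ce_boundary R L br 4 w) = \<zero>\<^bsub>killing_module R L br\<^esub>"
proof -
  let ?K = "killing_module R L br" and ?E = "ext_power R L 3"
  interpret K: module R ?K by (rule module_killing_module)
  interpret E: module R ?E by (rule module_ext)
  note add = is_linearD(2)[OF is_linear_koszul_map]
  note neg = is_linear_neg[OF module_ext module_killing_module is_linear_koszul_map]
  have gen: "koszul_map R L br (ce_sum 4 [x, y, z, t]) = \<zero>\<^bsub>?K\<^esub>"
    if c: "x \<in> carrier L" "y \<in> carrier L" "z \<in> carrier L" "t \<in> carrier L" for x y z t
  proof -
    note kc = kill_form_closed br_closed
    define P Q S where "P = kill_form (br x y) (br z t)" and "Q = kill_form (br x z) (br y t)"
      and "S = kill_form (br x t) (br y z)"
    have PQS: "P \<in> carrier ?K" "Q \<in> carrier ?K" "S \<in> carrier ?K"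
      using c by (simp_all add: P_def Q_def S_def kc)
    have comm: "kill_form (br z t) (br x y) = P" "kill_form (br y t) (br x z) = Q" "kill_form (br y z) (br x t) = S"
      using c by (simp_all add: P_def Q_def S_def kill_form_commute br_closed)
    have "P = kill_form x (br y (br z t))" "Q = kill_form x (br z (br y t))" "S = kill_form x (br t (br y z))"
      using c by (simp_all add: P_def Q_def S_def kill_form_invariant br_closed)
    \<comment> \<open>The Jacobi sum contains \<open>br t y\<close> where \<open>Q\<close> contains
      \<open>br y t\<close>; hence the sign of \<open>Q\<close>.\<close>
    moreover have "br z (br t y) = \<ominus>\<^bsub>L\<^esub> br z (br y t)"
      using c br_swap[of y t] is_linear_neg[OF module_L module_L is_linear_br_right[of z]] by (simp add: br_closed)
    ultimately have "P \<oplus>\<^bsub>?K\<^esub> \<ominus>\<^bsub>?K\<^esub> Q \<oplus>\<^bsub>?K\<^esub> S =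
        kill_form x (br y (br z t) \<oplus>\<^bsub>L\<^esub> br z (br t y) \<oplus>\<^bsub>L\<^esub> br t (br y z))"
      using c is_linearD(2)[OF is_linear_kill_form_right[of x]] by (simp add: kill_form_neg_right br_closed)
    then have jac: "P \<oplus>\<^bsub>?K\<^esub> \<ominus>\<^bsub>?K\<^esub> Q \<oplus>\<^bsub>?K\<^esub> S = \<zero>\<^bsub>?K\<^esub>"
      using c jacobi[of y z t] by (simp add: kill_form_zero_right)
    then have Q: "Q = P \<oplus>\<^bsub>?K\<^esub> S"
      using PQS K.M.minus_equality[of "P \<oplus>\<^bsub>?K\<^esub> S" "\<ominus>\<^bsub>?K\<^esub> Q"] by (simp add: K.M.a_ac)
    have "koszul_map R L br (ce_sum 4 [x, y, z, t]) =
        \<ominus>\<^bsub>?K\<^esub> P \<oplus>\<^bsub>?K\<^esub> (Q \<oplus>\<^bsub>?K\<^esub> (\<ominus>\<^bsub>?K\<^esub> S \<oplus>\<^bsub>?K\<^esub> (\<ominus>\<^bsub>?K\<^esub> S \<oplus>\<^bsub>?K\<^esub> (Q \<oplus>\<^bsub>?K\<^esub> \<ominus>\<^bsub>?K\<^esub> P))))"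
      using c by (simp add: ce_sum_4 add neg koszul_map comm wedge_3_closed br_closed flip: P_def Q_def S_def)
    also have "\<dots> = \<zero>\<^bsub>?K\<^esub>"
      unfolding Q using PQS(1,3) by (simp add: K.M.a_assoc K.M.l_neg K.M.r_neg K.M.r_neg1 K.M.r_neg2 K.M.four_cancel)
    finally show ?thesis .
  qed
  show ?thesis
  proof (rule generates_eqI[OF module_ext module_killing_module
        is_linear_compose[OF is_linear_ce_boundary_4 is_linear_koszul_map]
        is_linear_const_zero[OF module_killing_module] generates_wedge[OF module_L] _ assms])
    fix w assume "w \<in> wedge R L ` tuples L 4"
    then obtain xs where xs: "xs \<in> tuples L 4" "w = wedge R L xs" by blast
    then obtain x y z t where "xs = [x, y, z, t]"
      by (auto simp: tuples_def length_Suc_conv eval_nat_numeral)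
    with xs show "koszul_map R L br (ce_boundary R L br 4 w) = \<zero>\<^bsub>?K\<^esub>"
      using gen by (simp add: ce_boundary_4 tuples_4_iff)
  qed
qed

text \<open>\<eta> is factored through the quotient of the whole exterior cube by the boundaries and
  restricted to the cosets of cycles, which form the homology module.\<close>

lemma reduced_koszul_map_class:
  assumes z: "z \<in> ce_cycles R L br 3"
  shows "reduced_koszul_map R L br (homology_class R L br 3 z) = koszul_map R L br z"
proof -
  let ?E = "ext_power R L 3" and ?K = "killing_module R L br"
  let ?B = "ce_boundaries R L br 3" and ?Z = "ce_cycles R L br 3" and ?H = "ce_homology R L br 3"
  have Beq: "?B = ce_boundary R L br 4 ` carrier (ext_power R L 4)"
    by (simp add: ce_boundaries_def)
  have B: "submodule ?B R ?E"
    unfolding Beq by (rule submodule_image[OF module_ext module_ext is_linear_ce_boundary_4])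
  have Z: "submodule ?Z R ?E"
    using submodule_kernel[OF module_ext module_ext is_linear_ce_boundary_3] by (simp add: ce_cycles_def)
  note ZE = submodule_memD(1)[OF module_ext Z]
  let ?p = "\<lambda>x. ?B +>\<^bsub>?E\<^esub> x" and ?Q = "quot_mod ?E ?B"
  have Q: "module R ?Q" by (rule module_quot_mod[OF module_ext B])
  have mZ: "module R (?E\<lparr>carrier := ?Z\<rparr>)"
    by (rule submodule.submodule_is_module[OF Z module_ext])
  have "is_linear R (?E\<lparr>carrier := ?Z\<rparr>) ?Q ?p"
    using is_linear_coset[OF module_ext B] ZE by (auto simp: is_linear_def)
  from submodule_image[OF mZ Q this] have pZ: "submodule (?p ` ?Z) R ?Q" by simp
  \<comment> \<open>Restricting to cycles before or after passing to cosets gives the same record,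
    because set addition, cosets and scalars use the operations and not the carrier.\<close>
  have H: "?H = ?Q\<lparr>carrier := ?p ` ?Z\<rparr>"
  proof -
    have "(<+>\<^bsub>?E\<lparr>carrier := ?Z\<rparr>\<^esub>) = (<+>\<^bsub>?E\<^esub>)"
      by (intro ext) (simp add: set_add_def set_mult_def)
    then show ?thesis
      by (auto simp: ce_homology_def quot_mod_def A_RCOSETS_def' a_r_coset_def r_coset_def)
  qed
  have mH: "module R ?H" unfolding H by (rule submodule.submodule_is_module[OF pZ Q])
  obtain g where g: "is_linear R ?Q ?K g" "\<And>x. x \<in> carrier ?E \<Longrightarrow> g (?p x) = koszul_map R L br x"
    using quot_mod_universal[OF module_ext B module_killing_module is_linear_koszul_map]
      koszul_map_ce_boundary_4 unfolding Beq by blast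
  have gH: "is_linear R ?H ?K g"
    using g(1) submodule_memD(1)[OF Q pZ] by (auto simp: H is_linear_def)
  \<comment> \<open>Every element of the homology is the class of a cycle, so the generators are the
    whole carrier.\<close>
  have gen: "generates R ?H (homology_class R L br 3 ` ?Z)"
    by (auto simp: generates_def H homology_class_def)
  have "g (homology_class R L br 3 x) = koszul_map R L br x" if "x \<in> ?Z" for x
    using g(2)[OF ZE[OF that]] by (simp add: homology_class_def)
  from the_lin_props(2)[OF mH module_killing_module gen gH this z]
  show ?thesis unfolding reduced_koszul_map_def .
qed

text \<open>The rational character enters through the scalars \<open>c a\<close> in
  \<open>R\<close>, additive in the degree and equal to one at \<open>\<alpha>\<close>; all
  computations then take place in modules over \<open>R\<close>.\<close>

lemma koszul_map_homogeneous:
  assumes A: "abelian_group A" and gr: "lie_grading R L br A G"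
    and c: "\<And>a. a \<in> carrier A \<Longrightarrow> c a \<in> carrier R"
    and cadd: "\<And>a b. a \<in> carrier A \<Longrightarrow> b \<in> carrier A \<Longrightarrow> c (a \<oplus>\<^bsub>A\<^esub> b) = c a \<oplus>\<^bsub>R\<^esub> c b"
    and one: "c \<alpha> = \<one>\<^bsub>R\<^esub>"
    and z: "z \<in> ce_cycles R L br 3" "z \<in> ext_power_deg R L A G 3 \<alpha>"
  shows "koszul_map R L br z = \<zero>\<^bsub>killing_module R L br\<^esub>"
proof -
  let ?K = "killing_module R L br" and ?E = "ext_power R L 3"
  interpret A: abelian_group A by fact
  interpret K: module R ?K by (rule module_killing_module)
  interpret E: module R ?E by (rule module_ext)
  interpret E2: module R "ext_power R L 2" by (rule module_ext)
  have ds: "internal_direct_sum R L (carrier A) G"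
    and brG: "\<And>a b x y. a \<in> carrier A \<Longrightarrow> b \<in> carrier A \<Longrightarrow> x \<in> G a \<Longrightarrow> y \<in> G b \<Longrightarrow> br x y \<in> G (a \<oplus>\<^bsub>A\<^esub> b)"
    using gr by (auto simp: lie_grading_def)
  have GL: "x \<in> carrier L" if "a \<in> carrier A" "x \<in> G a" for a x
    by (rule submodule_memD(1)[OF module_L _ that(2)]) (use ds that(1) in \<open>simp add: internal_direct_sum_def\<close>)
  obtain D where D: "is_linear R L L D" "\<And>a x. a \<in> carrier A \<Longrightarrow> x \<in> G a \<Longrightarrow> D x = c a \<odot>\<^bsub>L\<^esub> x"
    by (rule grading_scaling[OF module_L ds c]) (simp, erule that, simp)
  note Dc = is_linearD(1)[OF D(1)]
  define b where "b u v = kill_form (D u) v \<ominus>\<^bsub>?K\<^esub> kill_form u (D v)" for u v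
  have "multilin R L 2 ?K (\<lambda>xs. b (xs ! 0) (xs ! 1))"
  proof (rule multilinI)
    fix xs assume "xs \<in> tuples L 2"
    then obtain u v where xs: "xs = [u, v]" "u \<in> carrier L" "v \<in> carrier L"
      by (auto simp: tuples_def length_Suc_conv eval_nat_numeral)
    show "b (xs ! 0) (xs ! 1) \<in> carrier ?K" using xs by (simp add: b_def kill_form_closed Dc K.M.minus_closed)
    fix i :: nat assume "i < 2"
    then consider "i = 0" | "i = 1" by linarith
    then show "is_linear R L ?K (\<lambda>x. b (xs[i := x] ! 0) (xs[i := x] ! 1))"
    proof cases
      case 1
      have "is_linear R L ?K (\<lambda>x. b x v)" unfolding b_def
        by (intro is_linear_diff module_killing_module is_linear_compose[OF D(1) is_linear_kill_form_left]
            is_linear_kill_form_left Dc xs(2,3))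
      then show ?thesis using 1 xs by simp
    next
      case 2
      have "is_linear R L ?K (\<lambda>x. b u x)" unfolding b_def
        by (intro is_linear_diff module_killing_module is_linear_compose[OF D(1) is_linear_kill_form_right]
            is_linear_kill_form_right Dc xs(2,3))
      then show ?thesis using 2 xs by simp
    qed
  qed
  moreover have "b (xs ! 0) (xs ! 1) = \<zero>\<^bsub>?K\<^esub>" if xs2: "xs \<in> tuples L 2" and nd: "\<not> distinct xs" for xs
  proof -
    obtain u v where xs: "xs = [u, v]" "u \<in> carrier L" "v \<in> carrier L"
      using xs2 by (auto simp: tuples_def length_Suc_conv eval_nat_numeral)
    then have "u = v" using nd by auto
    then show ?thesis using xs
      by (simp add: b_def kill_form_commute[of "D v" v] Dc K.M.minus_eq K.M.r_neg kill_form_closed)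
  qed
  ultimately obtain \<theta> where \<theta>: "is_linear R (ext_power R L 2) ?K \<theta>"
      "\<And>xs. xs \<in> tuples L 2 \<Longrightarrow> \<theta> (wedge R L xs) = b (xs ! 0) (xs ! 1)"
    using ext_power_universal[OF module_L module_killing_module] by blast
  have \<theta>G: "\<theta> (wedge R L [u, v]) = (c p \<ominus>\<^bsub>R\<^esub> c q) \<odot>\<^bsub>?K\<^esub> kill_form u v"
    if "p \<in> carrier A" "q \<in> carrier A" "u \<in> G p" "v \<in> G q" for u v p q
  proof -
    have uv: "u \<in> carrier L" "v \<in> carrier L" using GL that by auto
    have "\<theta> (wedge R L [u, v]) = b u v" using \<theta>(2)[of "[u, v]"] uv by (simp add: tuples_2_iff)
    also have "\<dots> = c p \<odot>\<^bsub>?K\<^esub> kill_form u v \<ominus>\<^bsub>?K\<^esub> c q \<odot>\<^bsub>?K\<^esub> kill_form u v"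
      using that uv c is_linearD(3)[OF is_linear_kill_form_left] is_linearD(3)[OF is_linear_kill_form_right]
      by (simp add: b_def D(2))
    also have "\<dots> = (c p \<ominus>\<^bsub>R\<^esub> c q) \<odot>\<^bsub>?K\<^esub> kill_form u v"
      using that uv c by (simp add: a_minus_def K.smult_l_distr K.smult_l_minus kill_form_closed)
    finally show ?thesis .
  qed
  let ?\<eta> = "koszul_map R L br" and ?\<delta> = "ce_boundary R L br 3"
  \<comment> \<open>The coefficient relating the two sides depends on the degree, so the identity is
    posed as a submodule that must contain the generators of degree \<open>\<alpha>\<close>.\<close>
  let ?H = "{w \<in> carrier ?E. \<theta> (?\<delta> w) = \<ominus>\<^bsub>?K\<^esub> ?\<eta> w}"
  have "submodule ?H R ?E"
    by (rule submodule_equalizer[OF module_ext module_killing_module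
          is_linear_compose[OF is_linear_ce_boundary_3 \<theta>(1)]
          is_linear_uminus[OF module_killing_module is_linear_koszul_map]])
  then have "ext_power_deg R L A G 3 \<alpha> \<subseteq> ?H"
    unfolding ext_power_deg_def
  proof (rule submod_span_least, intro subsetI)
    fix w assume "w \<in> {wedge R L xs | xs d. length xs = 3 \<and> d \<in> {..<3} \<rightarrow> carrier A \<and>
         (\<forall>i<3. xs ! i \<in> G (d i)) \<and> (\<Oplus>\<^bsub>A\<^esub>i\<in>{..<3}. d i) = \<alpha>}"
    then obtain xs d where w: "w = wedge R L xs" and len: "length xs = 3"
      and d: "d \<in> {..<3} \<rightarrow> carrier A" and xsG: "\<forall>i<3. xs ! i \<in> G (d i)"
      and sum: "(\<Oplus>\<^bsub>A\<^esub>i\<in>{..<3}. d i) = \<alpha>"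
      by blast
    obtain x y z where xs: "xs = [x, y, z]"
      using len by (auto simp: length_Suc_conv eval_nat_numeral)
    have dA: "d 0 \<in> carrier A" "d 1 \<in> carrier A" "d 2 \<in> carrier A" using d by auto
    have G: "x \<in> G (d 0)" "y \<in> G (d 1)" "z \<in> G (d 2)"
      using xsG[rule_format, of 0] xsG[rule_format, of 1] xsG[rule_format, of 2] xs by auto
    have xyz: "x \<in> carrier L" "y \<in> carrier L" "z \<in> carrier L" using G GL dA by auto
    have wE: "wedge R L xs \<in> carrier ?E" using xyz xs by (simp add: wedge_3_closed)
    have "{..<3::nat} = {0, 1, 2}" by auto
    then have "(\<Oplus>\<^bsub>A\<^esub>i\<in>{..<3}. d i) = d 0 \<oplus>\<^bsub>A\<^esub> (d 1 \<oplus>\<^bsub>A\<^esub> d 2)"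
      using dA by simp
    then have sum1: "c (d 0) \<oplus>\<^bsub>R\<^esub> (c (d 1) \<oplus>\<^bsub>R\<^esub> c (d 2)) = \<one>\<^bsub>R\<^esub>"
      using one sum dA cadd by simp
    define \<kappa> where "\<kappa> = kill_form x (br y z)"
    have \<kappa>: "\<kappa> \<in> carrier ?K" using xyz by (simp add: \<kappa>_def kill_form_closed br_closed)
    \<comment> \<open>Invariance and symmetry bring \<open>x\<close> to the first place; the middle
      pairing then ends in \<open>br z y\<close>, hence its sign.\<close>
    have k: "kill_form (br x y) z = \<kappa>" "kill_form (br x z) y = \<ominus>\<^bsub>?K\<^esub> \<kappa>" "kill_form (br y z) x = \<kappa>"
      using xyz kill_form_commute[of "br y z" x]
      by (simp_all only: \<kappa>_def kill_form_invariant[of x] br_swap[of y z] kill_form_neg_right br_closed)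
    \<comment> \<open>For a bracket of entries of degrees \<open>p\<close> and \<open>q\<close>,
      with remaining entry of degree \<open>s\<close>, this is the scalar of the bracket minus that
      of the remaining entry.\<close>
    let ?r = "\<lambda>p q s. c p \<oplus>\<^bsub>R\<^esub> c q \<ominus>\<^bsub>R\<^esub> c s"
    have r: "?r p q s \<in> carrier R" if "p \<in> carrier A" "q \<in> carrier A" "s \<in> carrier A" for p q s
      using that c by (simp add: a_minus_def)
    have "\<theta> (?\<delta> (wedge R L xs)) = \<ominus>\<^bsub>?K\<^esub> \<theta> (wedge R L [br x y, z]) \<oplus>\<^bsub>?K\<^esub>
        (\<theta> (wedge R L [br x z, y]) \<oplus>\<^bsub>?K\<^esub> \<ominus>\<^bsub>?K\<^esub> \<theta> (wedge R L [br y z, x]))"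
      using xyz xs ce_boundary_3[of xs] is_linearD(2)[OF \<theta>(1)] is_linear_neg[OF module_ext module_killing_module \<theta>(1)]
      by (simp add: tuples_3_iff ce_sum_3 wedge_2_closed br_closed)
    also have "\<dots> = \<ominus>\<^bsub>?K\<^esub> (?r (d 0) (d 1) (d 2) \<odot>\<^bsub>?K\<^esub> \<kappa>) \<oplus>\<^bsub>?K\<^esub>
        (\<ominus>\<^bsub>?K\<^esub> (?r (d 0) (d 2) (d 1) \<odot>\<^bsub>?K\<^esub> \<kappa>) \<oplus>\<^bsub>?K\<^esub> \<ominus>\<^bsub>?K\<^esub> (?r (d 1) (d 2) (d 0) \<odot>\<^bsub>?K\<^esub> \<kappa>))"
      using \<theta>G[OF _ dA(3) brG[OF dA(1,2) G(1,2)] G(3)] \<theta>G[OF _ dA(2) brG[OF dA(1,3) G(1,3)] G(2)]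
        \<theta>G[OF _ dA(1) brG[OF dA(2,3) G(2,3)] G(1)] dA r cadd \<kappa>
      by (simp add: k K.smult_r_minus)
    also have "\<dots> = \<ominus>\<^bsub>?K\<^esub> ((?r (d 0) (d 1) (d 2) \<oplus>\<^bsub>R\<^esub> (?r (d 0) (d 2) (d 1) \<oplus>\<^bsub>R\<^esub> ?r (d 1) (d 2) (d 0))) \<odot>\<^bsub>?K\<^esub> \<kappa>)"
      using dA r \<kappa> by (simp add: K.smult_l_distr K.M.minus_add)
    also have "?r (d 0) (d 1) (d 2) \<oplus>\<^bsub>R\<^esub> (?r (d 0) (d 2) (d 1) \<oplus>\<^bsub>R\<^esub> ?r (d 1) (d 2) (d 0)) =
        c (d 0) \<oplus>\<^bsub>R\<^esub> (c (d 1) \<oplus>\<^bsub>R\<^esub> c (d 2))"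
      using dA c by (intro R.sum_of_differences)
    finally have "\<theta> (?\<delta> (wedge R L xs)) = \<ominus>\<^bsub>?K\<^esub> ?\<eta> (wedge R L xs)"
      using \<kappa> xyz unfolding sum1 by (simp add: xs koszul_map \<kappa>_def)
    then show "w \<in> ?H" using w wE by simp
  qed
  then have zH: "z \<in> carrier ?E" "\<theta> (?\<delta> z) = \<ominus>\<^bsub>?K\<^esub> ?\<eta> z" using z(2) by auto
  have "?\<delta> z = \<zero>\<^bsub>ext_power R L 2\<^esub>" using z(1) by (simp add: ce_cycles_def)
  then have "\<ominus>\<^bsub>?K\<^esub> ?\<eta> z = \<zero>\<^bsub>?K\<^esub>"
    using zH(2) is_linear_zero[OF module_ext module_killing_module \<theta>(1)] by simp
  then show ?thesis
    using is_linearD(1)[OF is_linear_koszul_map zH(1)] by (metis K.M.minus_minus K.M.a_inv_zero)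
qed

end

theorem theorem1p2:
  fixes R :: "('r, 'k) ring_scheme"
    and \<iota> :: "rat \<Rightarrow> 'r"
    and \<gg> :: "('r, 'g, 'u) module_scheme"
    and br :: "'g \<Rightarrow> 'g \<Rightarrow> 'g"
    and A :: "('a, 'l) ring_scheme"
    and G :: "'a \<Rightarrow> 'g set"
  assumes "cring R"
    and "\<iota> \<in> ring_hom (ring_of_type_algebra :: rat ring) R"
    and "lie_algebra R \<gg> br"
    and "abelian_group A"
    and "torsion_free_group A"
    and "lie_grading R \<gg> br A G"
  shows "\<forall>\<alpha> \<in> carrier A - {\<zero>\<^bsub>A\<^esub>}.
    reduced_koszul_map R \<gg> br ` ce_homology_deg R \<gg> br A G 3 \<alpha> = {\<zero>\<^bsub>killing_module R \<gg> br\<^esub>}"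
proof
  fix \<alpha> assume \<alpha>: "\<alpha> \<in> carrier A - {\<zero>\<^bsub>A\<^esub>}"
  interpret A: abelian_group A by fact
  interpret L: lie_algebra R \<gg> br by fact
  obtain f :: "'a \<Rightarrow> rat" where f: "f \<alpha> = 1"
    "\<And>a b. a \<in> carrier A \<Longrightarrow> b \<in> carrier A \<Longrightarrow> f (a \<oplus>\<^bsub>A\<^esub> b) = f a + f b"
    using A.torsion_free_rat_character[OF assms(5), of \<alpha>] \<alpha> by auto
  \<comment> \<open>\<open>\<iota>\<close> is the structure map of the rational algebra; composed
    with \<open>f\<close> it yields the scalars by which the components are scaled.\<close>
  have \<iota>: "\<iota> x \<in> carrier R" "\<iota> (x + y) = \<iota> x \<oplus>\<^bsub>R\<^esub> \<iota> y" "\<iota> 1 = \<one>\<^bsub>R\<^esub>" for x y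
    using assms(2) by (auto simp: ring_hom_def ring_of_type_algebra_def)
  let ?ZA = "ce_cycles R \<gg> br 3 \<inter> ext_power_deg R \<gg> A G 3 \<alpha>"
  have "reduced_koszul_map R \<gg> br (homology_class R \<gg> br 3 z) = \<zero>\<^bsub>killing_module R \<gg> br\<^esub>"
    if "z \<in> ?ZA" for z
    using that L.reduced_koszul_map_class[of z]
      L.koszul_map_homogeneous[OF assms(4,6), of "\<lambda>a. \<iota> (f a)" \<alpha> z] \<iota> f by simp
  \<comment> \<open>The claim is an equality with the singleton of zero, so the part of degree
    \<open>\<alpha>\<close> has to be nonempty; zero is a homogeneous cycle of every degree.\<close>
  moreover have "\<zero>\<^bsub>ext_power R \<gg> 3\<^esub> \<in> ?ZA"
  proof
    interpret E: module R "ext_power R \<gg> 3" by (rule L.module_ext)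
    show "\<zero>\<^bsub>ext_power R \<gg> 3\<^esub> \<in> ce_cycles R \<gg> br 3"
      using is_linear_zero[OF L.module_ext L.module_ext L.is_linear_ce_boundary_3]
      by (simp add: ce_cycles_def)
    show "\<zero>\<^bsub>ext_power R \<gg> 3\<^esub> \<in> ext_power_deg R \<gg> A G 3 \<alpha>"
      by (auto simp: ext_power_deg_def submod_span_def intro: submodule_memD(2)[OF L.module_ext])
  qed
  ultimately show "reduced_koszul_map R \<gg> br ` ce_homology_deg R \<gg> br A G 3 \<alpha> = {\<zero>\<^bsub>killing_module R \<gg> br\<^esub>}"
    unfolding ce_homology_deg_def image_image by blast
qed

end
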